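(* Let $A$ be a Banach algebra, $B$ a Banach $A$-bimodule, and $n\ge 2$ an even number. Then the following hold. (1) If $e^{(n)}\in A^{(n)}$ is a right unit for $B^{(n)}$ and $Z^\ell_{e^{(n)}}(B^{(n)})=B^{(n)}$, then $A^{(n-2)}B^{(n-1)}=B^{(n-1)}$. (2) If $e^{(n)}\in A^{(n)}$ is a left unit for $B^{(n)}$ and $Z^r_{e^{(n)}}(B^{(n)})=B^{(n)}$, then $B^{(n-1)}A^{(n-2)}=B^{(n-1)}$. (3) If $e^{(n)}\in A^{(n)}$ is a right unit for $B^{(n)}$ and $\tilde Z^\ell_{e^{(n)}}(B^{(n)})=B^{(n)}$, then $A^{(n-2)}B^{(n-1)}=B^{(n-1)}$ and the weak$^*$ closure of $A^{(n-2)}B^{(n+1)}$ is $B^{(n+1)}$. (4) If $e^{(n)}\in A^{(n)}$ is a left unit for $B^{(n)}$ and $\tilde Z^r_{e^{(n)}}(B^{(n)})=B^{(n)}$, then $B^{(n-1)}A^{(n-2)}=B^{(n-1)}$ and the weak$^*$ closure of $B^{(n+1)}A^{(n-2)}$ is $B^{(n+1)}$.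
   Context: $X^{(n)}$ denotes the $n$-th dual of $X$, $X^{(0)}=X$, and spaces are identified with their canonical images in biduals. For a bounded bilinear map $m:X\times Y\to Z$, define $\langle m^*(z',x),y\rangle=\langle z',m(x,y)\rangle$, $\langle m^{**}(y'',z'),x\rangle=\langle y'',m^*(z',x)\rangle$, $\langle m^{***}(x'',y''),z'\rangle=\langle x'',m^{**}(y'',z')\rangle$, so $m^{***}:X^{**}\times Y^{**}\to Z^{**}$; and $m^t(y,x)=m(x,y)$. If $\pi_\ell:A\times B\to B$, $\pi_r:B\times A\to B$ are the module actions ($\pi_\ell(a,b)=ab$, $\pi_r(b,a)=ba$), then $A^{**}$ carries the first Arens product (the $^{***}$-extension of the multiplication) and $B^{**}$ is an $A^{**}$-bimodule with $a''b''=\pi_\ell^{***}(a'',b'')$, $b''a''=\pi_r^{***}(b'',a'')$. Iterating, for even $n$, $A^{(n)}$ is a Banach algebra and $B^{(n)}$ a Banach $A^{(n)}$-bimodule; $B^{(n+1)}$ is its dual $A^{(n)}$-bimodule: $\langle b^{(n+1)}a^{(n)},b^{(n)}\rangle=\langle b^{(n+1)},a^{(n)}b^{(n)}\rangle$, $\langle a^{(n)}b^{(n+1)},b^{(n)}\rangle=\langle b^{(n+1)},b^{(n)}a^{(n)}\rangle$ (and likewise $B^{(n-1)}$ is an $A^{(n-2)}$-bimodule; $A^{(n-2)}$ acts on $B^{(n+1)}$ via $A^{(n-2)}\subseteq A^{(n)}$). $XY=\{xy:x\in X,y\in Y\}$. $e^{(n)}$ is a right (left) unit for $B^{(n)}$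 if it is a right (left) unit element of $A^{(n)}$ and $b^{(n)}e^{(n)}=b^{(n)}$ (resp. $e^{(n)}b^{(n)}=b^{(n)}$) for all $b^{(n)}\in B^{(n)}$. A map $f$ on $A^{(n)}$ is weak$^*$-weak$^*$ (weak$^*$-weak) point continuous at $x$ if for every net $x_\alpha\to x$ weak$^*$ in $A^{(n)}$ one has $f(x_\alpha)\to f(x)$ weak$^*$ (weakly). For $x\in A^{(n)}$: $Z^\ell_{x}(B^{(n)})$ is the set of $b\in B^{(n)}$ such that $a\mapsto ba$ from $A^{(n)}$ to $B^{(n)}$ is weak$^*$-weak$^*$ point continuous at $x$; $Z^r_{x}(B^{(n)})$ is the set of $b\in B^{(n)}$ such that $a\mapsto \pi_\ell^{t***}(b,a)$ from $A^{(n)}$ to $B^{(n)}$ is weak$^*$-weak$^*$ point continuous at $x$, where here $\pi_\ell$ is the left action of $A^{(n-2)}$ on $B^{(n-2)}$; $\tilde Z^\ell_{x}(B^{(n)})$ is the set of $b\in B^{(n)}$ such that $a\mapsto ba$ is weak$^*$-weak point continuous at $x$; $\tilde Z^r_{x}(B^{(n)})$ is the set of $b\in B^{(n)}$ such that $a\mapsto ab$ is weak$^*$-weak point continuous at $x$. *)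

theory Defs
  imports "HOL-Analysis.Analysis"
begin

section \<open>Scalars\<close>

text \<open>The scalar field is \<open>\<real>\<close> (case \<open>i = 0\<close>) or \<open>\<complex>\<close> (case \<open>i * i = -1\<close>).\<close>

class real_or_complex = real_normed_field +
  assumes real_or_complex:
    "\<exists>i. (i = 0 \<or> i * i = - 1) \<and> (\<forall>z. \<exists>a b. z = a *\<^sub>R 1 + b *\<^sub>R i)"

instance real :: real_or_complex
  by standard (rule exI[of _ 0], auto)

instance complex :: real_or_complex
proof
  have "z = Re z *\<^sub>R 1 + Im z *\<^sub>R \<i>" for z
    by (simp add: complex_eq_iff)
  then show "\<exists>i::complex. (i = 0 \<or> i * i = - 1) \<and> (\<forall>z. \<exists>a b. z = a *\<^sub>R 1 + b *\<^sub>R i)"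
    by (intro exI[of _ \<i>]) auto
qed


section \<open>A Banach space and its iterated duals\<close>

text \<open>
  The type of the \<open>n\<close>-th dual of a space depends on \<open>n\<close>, and no single HOL type contains the
  iterated duals of every order of an arbitrary space. For a given \<open>n\<close>, however, the spaces
  \<open>X\<^sup>(\<^sup>0\<^sup>), \<dots>, X\<^sup>(\<^sup>n\<^sup>)\<close> are finitely many normed spaces, so they embed isometrically into one normed
  space (for example their product). A record of the following type describes this situation:
  \<open>lev T k\<close> is (the copy in the ambient type \<open>'u\<close> of) \<open>X\<^sup>(\<^sup>k\<^sup>)\<close>, the vector operations and the norm
  are those of \<open>'u\<close>, scalar multiplication is \<open>scal T\<close>, and \<open>pair T k x' x\<close> is the value
  \<open>\<langle>x', x\<rangle>\<close> of \<open>x' \<in> X\<^sup>(\<^sup>k\<^sup>+\<^sup>1\<^sup>)\<close> at \<open>x \<in> X\<^sup>(\<^sup>k\<^sup>)\<close>. The different levels are not required to be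
  disjoint or nested; the canonical embedding of a level into its bidual is \<open>canon\<close> below.
\<close>

record ('k, 'u) dual_tower =
  scal :: "'k \<Rightarrow> 'u \<Rightarrow> 'u"
  lev :: "nat \<Rightarrow> 'u set"
  pair :: "nat \<Rightarrow> 'u \<Rightarrow> 'u \<Rightarrow> 'k"

definition normed_scaling :: "('k::real_or_complex \<Rightarrow> 'u::real_normed_vector \<Rightarrow> 'u) \<Rightarrow> bool" where
  "normed_scaling s \<longleftrightarrow>
     vector_space s \<and>
     (\<forall>r x. s (of_real r) x = r *\<^sub>R x) \<and>
     (\<forall>c x. norm (s c x) = norm c * norm x)"

definition bounded_functional ::
  "('k::real_or_complex \<Rightarrow> 'u::real_normed_vector \<Rightarrow> 'u) \<Rightarrow> 'u set \<Rightarrow> ('u \<Rightarrow> 'k) \<Rightarrow> bool" where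
  "bounded_functional s X f \<longleftrightarrow>
     (\<forall>x\<in>X. \<forall>y\<in>X. f (x + y) = f x + f y) \<and>
     (\<forall>c. \<forall>x\<in>X. f (s c x) = c * f x) \<and>
     (\<exists>K. \<forall>x\<in>X. norm (f x) \<le> K * norm x)"

text \<open>\<open>p\<close> identifies \<open>X'\<close> isometrically with the space of all bounded functionals on \<open>X\<close>.\<close>

definition is_dual ::
  "('k::real_or_complex \<Rightarrow> 'u::real_normed_vector \<Rightarrow> 'u) \<Rightarrow> 'u set \<Rightarrow> 'u set \<Rightarrow>
     ('u \<Rightarrow> 'u \<Rightarrow> 'k) \<Rightarrow> bool" where
  "is_dual s X X' p \<longleftrightarrow>
     module.subspace s X' \<and>
     (\<forall>f\<in>X'. bounded_functional s X (p f)) \<and>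
     (\<forall>\<phi>. bounded_functional s X \<phi> \<longrightarrow> (\<exists>!f. f \<in> X' \<and> (\<forall>x\<in>X. p f x = \<phi> x))) \<and>
     (\<forall>f\<in>X'. \<forall>g\<in>X'. \<forall>x\<in>X. p (f + g) x = p f x + p g x) \<and>
     (\<forall>c. \<forall>f\<in>X'. \<forall>x\<in>X. p (s c f) x = c * p f x) \<and>
     (\<forall>f\<in>X'. norm f = (SUP x\<in>{x\<in>X. norm x \<le> 1}. norm (p f x)))"

text \<open>\<open>lev T 0\<close> is a Banach space and \<open>lev T k\<close> is its \<open>k\<close>-th dual, for all \<open>k \<le> h\<close>.\<close>

definition iterated_duals :: "('k::real_or_complex, 'u::real_normed_vector) dual_tower \<Rightarrow> nat \<Rightarrow> bool"
  where
  "iterated_duals T h \<longleftrightarrow>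
     normed_scaling (scal T) \<and>
     module.subspace (scal T) (lev T 0) \<and> complete (lev T 0) \<and>
     (\<forall>k<h. is_dual (scal T) (lev T k) (lev T (Suc k)) (pair T k))"

text \<open>
  The abstract duals above are the usual ones: isometric copies of a real Banach space and of its
  dual inside one normed space satisfy \<open>is_dual\<close>.
\<close>

lemma is_dual_blinfun:
  fixes i :: "'v::real_normed_vector \<Rightarrow> 'u::real_normed_vector"
    and j :: "('v \<Rightarrow>\<^sub>L real) \<Rightarrow> 'u"
  assumes i: "linear i" "\<And>x. norm (i x) = norm x"
    and j: "linear j" "\<And>f. norm (j f) = norm f"
  shows "is_dual (*\<^sub>R) (range i) (range j)
           (\<lambda>f x. blinfun_apply (the_inv j f) (the_inv i x))"
proof -
  have "inj i" "inj j"
    using i j by (metis linear_injective_0 norm_eq_zero)+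
  then have [simp]: "the_inv i (i x) = x" "the_inv j (j f) = f" for x f
    by (simp_all add: the_inv_f_f)
  note lin = linear_add[OF i(1)] linear_scale[OF i(1)] linear_add[OF j(1)] linear_scale[OF j(1)]
  note lin_sym = lin[symmetric]
  have ball: "{x \<in> range i. norm x \<le> 1} = i ` cball 0 1"
    using i(2) by auto
  have nrm: "norm f = (SUP x\<in>cball 0 1. norm (blinfun_apply f x))" (is "_ = ?S") for f :: "'v \<Rightarrow>\<^sub>L real"
  proof (rule antisym)
    have le': "norm (blinfun_apply f x) \<le> norm f" if "norm x \<le> 1" for x
      using norm_blinfun[of f x] mult_left_le[OF that norm_ge_zero[of f]] by linarith
    then have bd: "bdd_above ((\<lambda>x. norm (blinfun_apply f x)) ` cball 0 1)"
      by (intro bdd_aboveI2[where M = "norm f"]) simp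
    have le: "norm (blinfun_apply f y) \<le> ?S" if "norm y \<le> 1" for y
      by (rule cSUP_upper[OF _ bd]) (use that in simp)
    show "norm f \<le> ?S"
    proof (rule norm_blinfun_bound)
      show "0 \<le> ?S" using le[of 0] by simp
      fix x
      show "norm (blinfun_apply f x) \<le> ?S * norm x"
      proof (cases "x = 0")
        case False
        have "norm (blinfun_apply f ((1 / norm x) *\<^sub>R x)) \<le> ?S"
          by (rule le) (use False in simp)
        then show ?thesis using False by (simp add: blinfun.scaleR_right divide_simps)
      qed simp
    qed
    show "?S \<le> norm f"
      by (rule cSUP_least) (use le' in auto)
  qed
  have ex: "\<exists>!g. g \<in> range j \<and> (\<forall>x\<in>range i. blinfun_apply (the_inv j g) (the_inv i x) = \<phi> x)"
    if \<phi>: "bounded_functional (*\<^sub>R) (range i) \<phi>" for \<phi>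
  proof -
    obtain K where K: "\<And>x. norm (\<phi> (i x)) \<le> K * norm x"
      using \<phi> i(2) unfolding bounded_functional_def by (metis rangeI)
    have "bounded_linear (\<lambda>x. \<phi> (i x))"
    proof (rule bounded_linear_intro[where K = K])
      show "\<phi> (i (x + y)) = \<phi> (i x) + \<phi> (i y)" for x y
        using \<phi> unfolding bounded_functional_def lin by blast
      show "\<phi> (i (r *\<^sub>R x)) = r *\<^sub>R \<phi> (i x)" for r x
        using \<phi> unfolding bounded_functional_def lin real_scaleR_def by blast
      show "norm (\<phi> (i x)) \<le> norm x * K" for x
        using K by (simp add: mult.commute)
    qed
    then obtain f where f: "\<And>x. blinfun_apply f x = \<phi> (i x)"
      by (metis bounded_linear_Blinfun_apply)
    show ?thesis
    proof (rule ex1I[of _ "j f"])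
      fix g assume "g \<in> range j \<and> (\<forall>x\<in>range i. blinfun_apply (the_inv j g) (the_inv i x) = \<phi> x)"
      then obtain h where "g = j h" "\<And>x. blinfun_apply h x = \<phi> (i x)" by auto
      then show "g = j f" using f by (metis blinfun_eqI)
    qed (use f in auto)
  qed
  have "subspace (range j)" using j(1) by (rule linear_subspace_image) simp
  moreover have "bounded_functional (*\<^sub>R) (range i) (\<lambda>x. blinfun_apply f (the_inv i x))" for f
    unfolding bounded_functional_def using norm_blinfun[of f] i(2)
    by (auto simp: lin_sym blinfun.add_right blinfun.scaleR_right)
  ultimately show ?thesis
    unfolding is_dual_def ball image_image subspace_raw_def using ex nrm j(2)
    by (auto simp: lin_sym blinfun.add_left blinfun.scaleR_left)
qed

text \<open>The canonical map of \<open>X\<^sup>(\<^sup>k\<^sup>)\<close> into \<open>X\<^sup>(\<^sup>k\<^sup>+\<^sup>2\<^sup>)\<close>.\<close>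

definition canon :: "('k, 'u) dual_tower \<Rightarrow> nat \<Rightarrow> 'u \<Rightarrow> 'u" where
  "canon T k x = (THE x''. x'' \<in> lev T (k + 2) \<and>
     (\<forall>x'\<in>lev T (k + 1). pair T (k + 1) x'' x' = pair T k x' x))"

definition weak_star :: "('k::real_or_complex, 'u) dual_tower \<Rightarrow> nat \<Rightarrow> 'u topology" where
  "weak_star T k = pullback_topology (lev T k) (\<lambda>x. \<lambda>y\<in>lev T (k - 1). pair T (k - 1) x y)
     (product_topology (\<lambda>_. euclidean) (lev T (k - 1)))"

definition weak :: "('k::real_or_complex, 'u) dual_tower \<Rightarrow> nat \<Rightarrow> 'u topology" where
  "weak T k = pullback_topology (lev T k) (\<lambda>x. \<lambda>f\<in>lev T (k + 1). pair T k f x)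
     (product_topology (\<lambda>_. euclidean) (lev T (k + 1)))"

text \<open>Net convergence is expressed through filters.\<close>

definition point_continuous :: "'a topology \<Rightarrow> 'b topology \<Rightarrow> ('a \<Rightarrow> 'b) \<Rightarrow> 'a \<Rightarrow> bool" where
  "point_continuous S T f x \<longleftrightarrow>
     (\<forall>F. limitin S (\<lambda>y. y) x F \<longrightarrow> limitin T f (f x) F)"


section \<open>Adjoints and Arens extensions of bilinear maps\<close>

text \<open>
  For \<open>m : X \<times> Y\<^sup>(\<^sup>j\<^sup>) \<rightarrow> Z\<^sup>(\<^sup>l\<^sup>)\<close>, \<open>adjoint Y j Z l m\<close> is the map \<open>m\<^sup>* : Z\<^sup>(\<^sup>l\<^sup>+\<^sup>1\<^sup>) \<times> X \<rightarrow> Y\<^sup>(\<^sup>j\<^sup>+\<^sup>1\<^sup>)\<close> with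
  \<open>\<langle>m\<^sup>*(z', x), y\<rangle> = \<langle>z', m(x, y)\<rangle>\<close>.
\<close>

definition adjoint ::
  "('k, 'y) dual_tower \<Rightarrow> nat \<Rightarrow> ('k, 'z) dual_tower \<Rightarrow> nat \<Rightarrow>
     ('x \<Rightarrow> 'y \<Rightarrow> 'z) \<Rightarrow> 'z \<Rightarrow> 'x \<Rightarrow> 'y" where
  "adjoint Y j Z l m z' x = (THE y'. y' \<in> lev Y (j + 1) \<and>
     (\<forall>y\<in>lev Y j. pair Y j y' y = pair Z l z' (m x y)))"

text \<open>\<open>m\<^sup>*\<^sup>*\<^sup>* : X\<^sup>(\<^sup>k\<^sup>+\<^sup>2\<^sup>) \<times> Y\<^sup>(\<^sup>k\<^sup>+\<^sup>2\<^sup>) \<rightarrow> Z\<^sup>(\<^sup>k\<^sup>+\<^sup>2\<^sup>)\<close> for \<open>m : X\<^sup>(\<^sup>k\<^sup>) \<times> Y\<^sup>(\<^sup>k\<^sup>) \<rightarrow> Z\<^sup>(\<^sup>k\<^sup>)\<close>.\<close>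

definition arens ::
  "('k, 'x) dual_tower \<Rightarrow> ('k, 'y) dual_tower \<Rightarrow> ('k, 'z) dual_tower \<Rightarrow> nat \<Rightarrow>
     ('x \<Rightarrow> 'y \<Rightarrow> 'z) \<Rightarrow> 'x \<Rightarrow> 'y \<Rightarrow> 'z" where
  "arens X Y Z k m =
     adjoint Z (k + 1) X (k + 1) (adjoint X k Y (k + 1) (adjoint Y k Z k m))"

text \<open>The map \<open>X\<^sup>(\<^sup>n\<^sup>) \<times> Y\<^sup>(\<^sup>n\<^sup>) \<rightarrow> Z\<^sup>(\<^sup>n\<^sup>)\<close> obtained from \<open>m : X \<times> Y \<rightarrow> Z\<close>; only even \<open>n\<close> are meaningful.\<close>

fun arens_iter ::
  "('k, 'x) dual_tower \<Rightarrow> ('k, 'y) dual_tower \<Rightarrow> ('k, 'z) dual_tower \<Rightarrow>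
     ('x \<Rightarrow> 'y \<Rightarrow> 'z) \<Rightarrow> nat \<Rightarrow> 'x \<Rightarrow> 'y \<Rightarrow> 'z" where
  "arens_iter X Y Z m 0 = m"
| "arens_iter X Y Z m (Suc 0) = undefined"
| "arens_iter X Y Z m (Suc (Suc n)) = arens X Y Z n (arens_iter X Y Z m n)"


section \<open>Banach algebras and Banach bimodules\<close>

definition bounded_bilinear_on ::
  "('k::real_or_complex, 'x::real_normed_vector) dual_tower \<Rightarrow>
     ('k, 'y::real_normed_vector) dual_tower \<Rightarrow> ('k, 'z::real_normed_vector) dual_tower \<Rightarrow>
     ('x \<Rightarrow> 'y \<Rightarrow> 'z) \<Rightarrow> bool" where
  "bounded_bilinear_on X Y Z m \<longleftrightarrow>
     (\<forall>x\<in>lev X 0. \<forall>y\<in>lev Y 0. m x y \<in> lev Z 0) \<and>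
     (\<forall>x\<in>lev X 0. \<forall>x'\<in>lev X 0. \<forall>y\<in>lev Y 0. m (x + x') y = m x y + m x' y) \<and>
     (\<forall>x\<in>lev X 0. \<forall>y\<in>lev Y 0. \<forall>y'\<in>lev Y 0. m x (y + y') = m x y + m x y') \<and>
     (\<forall>c. \<forall>x\<in>lev X 0. \<forall>y\<in>lev Y 0.
        m (scal X c x) y = scal Z c (m x y) \<and> m x (scal Y c y) = scal Z c (m x y)) \<and>
     (\<exists>K. \<forall>x\<in>lev X 0. \<forall>y\<in>lev Y 0. norm (m x y) \<le> K * norm x * norm y)"

definition banach_algebra ::
  "('k::real_or_complex, 'a::real_normed_vector) dual_tower \<Rightarrow> ('a \<Rightarrow> 'a \<Rightarrow> 'a) \<Rightarrow> bool" where
  "banach_algebra A mul \<longleftrightarrow>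
     bounded_bilinear_on A A A mul \<and>
     (\<forall>x\<in>lev A 0. \<forall>y\<in>lev A 0. \<forall>z\<in>lev A 0. mul (mul x y) z = mul x (mul y z)) \<and>
     (\<forall>x\<in>lev A 0. \<forall>y\<in>lev A 0. norm (mul x y) \<le> norm x * norm y)"

definition banach_bimodule ::
  "('k::real_or_complex, 'a::real_normed_vector) dual_tower \<Rightarrow> ('a \<Rightarrow> 'a \<Rightarrow> 'a) \<Rightarrow>
     ('k, 'b::real_normed_vector) dual_tower \<Rightarrow> ('a \<Rightarrow> 'b \<Rightarrow> 'b) \<Rightarrow> ('b \<Rightarrow> 'a \<Rightarrow> 'b) \<Rightarrow> bool" where
  "banach_bimodule A mul B pl pr \<longleftrightarrow>
     bounded_bilinear_on A B B pl \<and> bounded_bilinear_on B A B pr \<and>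
     (\<forall>x\<in>lev A 0. \<forall>y\<in>lev A 0. \<forall>b\<in>lev B 0.
        pl (mul x y) b = pl x (pl y b) \<and>
        pr b (mul x y) = pr (pr b x) y \<and>
        pr (pl x b) y = pl x (pr b y))"

text \<open>
  For even \<open>n\<close>: the product of \<open>A\<^sup>(\<^sup>n\<^sup>)\<close>, the actions of \<open>A\<^sup>(\<^sup>n\<^sup>)\<close> on \<open>B\<^sup>(\<^sup>n\<^sup>)\<close>, and the dual actions of
  \<open>A\<^sup>(\<^sup>n\<^sup>)\<close> on \<open>B\<^sup>(\<^sup>n\<^sup>+\<^sup>1\<^sup>)\<close>.
\<close>

definition amul ::
  "('k, 'a) dual_tower \<Rightarrow> ('a \<Rightarrow> 'a \<Rightarrow> 'a) \<Rightarrow> nat \<Rightarrow> 'a \<Rightarrow> 'a \<Rightarrow> 'a" where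
  "amul A mul n = arens_iter A A A mul n"

definition lact ::
  "('k, 'a) dual_tower \<Rightarrow> ('k, 'b) dual_tower \<Rightarrow> ('a \<Rightarrow> 'b \<Rightarrow> 'b) \<Rightarrow> nat \<Rightarrow> 'a \<Rightarrow> 'b \<Rightarrow> 'b" where
  "lact A B pl n = arens_iter A B B pl n"

definition ract ::
  "('k, 'a) dual_tower \<Rightarrow> ('k, 'b) dual_tower \<Rightarrow> ('b \<Rightarrow> 'a \<Rightarrow> 'b) \<Rightarrow> nat \<Rightarrow> 'b \<Rightarrow> 'a \<Rightarrow> 'b" where
  "ract A B pr n = arens_iter B A B pr n"

text \<open>\<open>\<langle>a b', b\<rangle> = \<langle>b', b a\<rangle>\<close> and \<open>\<langle>b' a, b\<rangle> = \<langle>b', a b\<rangle>\<close>.\<close>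

definition dual_lact ::
  "('k, 'a) dual_tower \<Rightarrow> ('k, 'b) dual_tower \<Rightarrow> ('b \<Rightarrow> 'a \<Rightarrow> 'b) \<Rightarrow> nat \<Rightarrow> 'a \<Rightarrow> 'b \<Rightarrow> 'b" where
  "dual_lact A B pr n a b' = adjoint B n B n (\<lambda>a b. ract A B pr n b a) b' a"

definition dual_ract ::
  "('k, 'a) dual_tower \<Rightarrow> ('k, 'b) dual_tower \<Rightarrow> ('a \<Rightarrow> 'b \<Rightarrow> 'b) \<Rightarrow> nat \<Rightarrow> 'b \<Rightarrow> 'a \<Rightarrow> 'b" where
  "dual_ract A B pl n b' a = adjoint B n B n (lact A B pl n) b' a"

definition products :: "('x \<Rightarrow> 'y \<Rightarrow> 'z) \<Rightarrow> 'x set \<Rightarrow> 'y set \<Rightarrow> 'z set" where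
  "products m X Y = {m x y | x y. x \<in> X \<and> y \<in> Y}"

definition right_unit where
  "right_unit A mul B pr n e \<longleftrightarrow>
     e \<in> lev A n \<and> (\<forall>a\<in>lev A n. amul A mul n a e = a) \<and> (\<forall>b\<in>lev B n. ract A B pr n b e = b)"

definition left_unit where
  "left_unit A mul B pl n e \<longleftrightarrow>
     e \<in> lev A n \<and> (\<forall>a\<in>lev A n. amul A mul n e a = a) \<and> (\<forall>b\<in>lev B n. lact A B pl n e b = b)"


section \<open>The sets \<open>Z\<^sup>\<ell>\<close>, \<open>Z\<^sup>r\<close> and their weak*-weak versions\<close>

definition Zl where
  "Zl A B pr n x = {b \<in> lev B n.
     point_continuous (weak_star A n) (weak_star B n) (\<lambda>a. ract A B pr n b a) x}"

text \<open>The map is \<open>a \<mapsto> \<pi>\<^sub>\<ell>\<^sup>t\<^sup>*\<^sup>*\<^sup>*(b, a)\<close>, with \<open>\<pi>\<^sub>\<ell>\<close> the left action of \<open>A\<^sup>(\<^sup>n\<^sup>-\<^sup>2\<^sup>)\<close> on \<open>B\<^sup>(\<^sup>n\<^sup>-\<^sup>2\<^sup>)\<close>.\<close>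

definition Zr where
  "Zr A B pl n x = {b \<in> lev B n.
     point_continuous (weak_star A n) (weak_star B n)
       (\<lambda>a. arens B A B (n - 2) (\<lambda>b a. lact A B pl (n - 2) a b) b a) x}"

definition Zl_weak where
  "Zl_weak A B pr n x = {b \<in> lev B n.
     point_continuous (weak_star A n) (weak B n) (\<lambda>a. ract A B pr n b a) x}"

definition Zr_weak where
  "Zr_weak A B pl n x = {b \<in> lev B n.
     point_continuous (weak_star A n) (weak B n) (\<lambda>a. lact A B pl n a b) x}"

end

theory Submission
  imports Defs
begin

text \<open>
  Write \<open>A\<close>, \<open>B'\<close> for \<open>A\<^sup>(\<^sup>n\<^sup>-\<^sup>2\<^sup>)\<close>, \<open>B\<^sup>(\<^sup>n\<^sup>-\<^sup>1\<^sup>)\<close>, and let \<open>e\<close> be the unit in \<open>A\<^sup>(\<^sup>n\<^sup>) = A''\<close>. Choose elements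
  \<open>x\<^sub>\<alpha>\<close> of \<open>A\<close> with weak* limit \<open>e\<close>. That \<open>e\<close> is a right unit means \<open>a x\<^sub>\<alpha> \<rightarrow> a\<close> weakly in \<open>A\<close>, and
  continuity of \<open>a'' \<mapsto> b'' a''\<close> at \<open>e\<close> means \<open>x\<^sub>\<alpha> b' \<rightarrow> b'\<close> weakly in \<open>B'\<close>, because
  \<open>\<langle>b'' x\<^sub>\<alpha>, b'\<rangle> = \<langle>b'', x\<^sub>\<alpha> b'\<rangle>\<close>. By Hahn--Banach separation, weak convergence is improved to a bounded
  family of elements of \<open>A\<close> that are approximate units in norm, for \<open>A\<close> from the right and for
  \<open>B'\<close> from the left simultaneously (\<open>bidual_unit_approx\<close>). This combination is what Cohen's
  construction uses to solve \<open>a z = b'\<close> (\<open>cohen_factorization\<close>), so \<open>A B' = B'\<close>.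

  The statements about left units are the same ones over the opposite algebra. There the weak
  convergence \<open>b' x\<^sub>\<alpha> \<rightarrow> b'\<close> is read off from the extension of \<open>\<pi>\<^sub>\<ell>\<^sup>t\<close> in the weak*-weak* case, and in the
  weak*-weak case from \<open>\<langle>x\<^sub>\<alpha> b'', b'\<rangle> = \<langle>b'', b' x\<^sub>\<alpha>\<rangle>\<close>.

  The weak* density of the products with \<open>B\<^sup>(\<^sup>n\<^sup>+\<^sup>1\<^sup>)\<close> is direct: weak*-weak continuity at \<open>e\<close> gives
  \<open>\<langle>x\<^sub>\<alpha> b''', b''\<rangle> = \<langle>b''', b'' x\<^sub>\<alpha>\<rangle> \<rightarrow> \<langle>b''', b''\<rangle>\<close> (\<open>weak_star_closure_of_action\<close>).

  No net is ever chosen. For the finitely many functionals that matter at a time, some \<open>x\<close> in \<open>A\<close> agrees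
  with \<open>e\<close> exactly (\<open>bidual_finite_agree\<close>), and the functional \<open>x \<mapsto> \<langle>b'', x b'\<rangle>\<close> on \<open>A\<close> is therefore
  mapped by \<open>e\<close> to \<open>\<langle>b'', b'\<rangle>\<close> (\<open>pairing_by_continuity\<close>). The bound on the approximate units comes from
  the separation argument, with the norm of \<open>e\<close> entering through \<open>norm (\<langle>e, f\<rangle>) \<le> norm e * norm f\<close>.
\<close>

section \<open>Hahn--Banach for a sublinear functional\<close>

definition sublinear :: "('w::real_vector \<Rightarrow> real) \<Rightarrow> bool" where
  "sublinear p \<longleftrightarrow> (\<forall>x y. p (x + y) \<le> p x + p y) \<and> (\<forall>t x. t \<ge> 0 \<longrightarrow> p (t *\<^sub>R x) = t * p x)"

lemma sublinearI:
  assumes "\<And>x y. p (x + y) \<le> p x + p y" "p 0 = 0" "\<And>t x. t > 0 \<Longrightarrow> p (t *\<^sub>R x) \<le> t * p x"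
  shows "sublinear p"
  unfolding sublinear_def
proof (intro conjI allI impI)
  fix t :: real and x assume "t \<ge> 0"
  show "p (t *\<^sub>R x) = t * p x"
  proof (cases "t = 0")
    case False
    with \<open>t \<ge> 0\<close> have t: "t > 0" by simp
    have "p ((1 / t) *\<^sub>R (t *\<^sub>R x)) \<le> (1 / t) * p (t *\<^sub>R x)"
      by (rule assms(3)) (use t in simp)
    then have "t * p x \<le> p (t *\<^sub>R x)" using t by (simp add: field_simps)
    with assms(3)[OF t, of x] show ?thesis by simp
  qed (use assms(2) in simp)
qed (rule assms(1))

lemma sublinear_add: "sublinear p \<Longrightarrow> p (x + y) \<le> p x + p y"
  and sublinear_scale: "sublinear p \<Longrightarrow> t \<ge> 0 \<Longrightarrow> p (t *\<^sub>R x) = t * p x"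
  by (auto simp: sublinear_def)

lemma sublinear_zero: "sublinear p \<Longrightarrow> p 0 = 0"
  using sublinear_scale[of p 0 0] by simp

lemma sublinear_minus: "sublinear p \<Longrightarrow> - p (- x) \<le> p x"
  using sublinear_add[of p x "- x"] sublinear_zero[of p] by simp

text \<open>
  The largest sublinear functional below \<open>p\<close> that is at most \<open>- p y\<close> at \<open>- y\<close>. It serves twice:
  a minimal sublinear functional equals its own tilts, which makes it additive, and tilting \<open>p\<close>
  along \<open>w\<close> at the start forces the linear functional found below \<open>p\<close> to attain \<open>p w\<close> at \<open>w\<close>.
\<close>

definition tilt :: "('w::real_vector \<Rightarrow> real) \<Rightarrow> 'w \<Rightarrow> 'w \<Rightarrow> real" where
  "tilt p y x = (INF t\<in>{0..}. p (x + t *\<^sub>R y) - t * p y)"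

lemma tilt_bdd:
  assumes "sublinear p"
  shows "bdd_below ((\<lambda>t. p (x + t *\<^sub>R y) - t * p y) ` {0..})"
proof (rule bdd_belowI2)
  fix t :: real assume "t \<in> {0..}"
  then have "t * p y = p (t *\<^sub>R y)" using sublinear_scale[OF assms, of t y] by simp
  also have "\<dots> \<le> p (x + t *\<^sub>R y) + p (- x)"
    using sublinear_add[OF assms, of "x + t *\<^sub>R y" "- x"] by simp
  finally show "- p (- x) \<le> p (x + t *\<^sub>R y) - t * p y" by simp
qed

lemma tilt_le:
  assumes "sublinear p" "t \<ge> 0"
  shows "tilt p y x \<le> p (x + t *\<^sub>R y) - t * p y"
  unfolding tilt_def by (rule cINF_lower[OF tilt_bdd[OF assms(1)]]) (use assms in simp)

lemma tilt_less:
  assumes "sublinear p" "tilt p y x < c"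
  obtains t where "t \<ge> 0" "p (x + t *\<^sub>R y) - t * p y < c"
  using assms cINF_less_iff[OF _ tilt_bdd[OF assms(1)], of x y c] unfolding tilt_def by auto

lemma tilt_sublinear:
  assumes p: "sublinear p"
  shows "sublinear (tilt p y)"
proof (rule sublinearI)
  fix x x'
  show "tilt p y (x + x') \<le> tilt p y x + tilt p y x'"
  proof (rule field_le_epsilon)
    fix d :: real assume "d > 0"
    obtain t where t: "t \<ge> 0" "p (x + t *\<^sub>R y) - t * p y < tilt p y x + d / 2"
      by (rule tilt_less[OF p, of y x "tilt p y x + d / 2"]) (use \<open>d > 0\<close> in auto)
    obtain t' where t': "t' \<ge> 0" "p (x' + t' *\<^sub>R y) - t' * p y < tilt p y x' + d / 2"
      by (rule tilt_less[OF p, of y x' "tilt p y x' + d / 2"]) (use \<open>d > 0\<close> in auto)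
    have "tilt p y (x + x') \<le> p ((x + x') + (t + t') *\<^sub>R y) - (t + t') * p y"
      using t t' by (intro tilt_le[OF p]) simp
    also have "(x + x') + (t + t') *\<^sub>R y = (x + t *\<^sub>R y) + (x' + t' *\<^sub>R y)"
      by (simp add: algebra_simps)
    also have "p \<dots> \<le> p (x + t *\<^sub>R y) + p (x' + t' *\<^sub>R y)" by (rule sublinear_add[OF p])
    finally show "tilt p y (x + x') \<le> tilt p y x + tilt p y x' + d"
      using t t' by (simp add: algebra_simps)
  qed
next
  have "tilt p y 0 \<le> 0" using tilt_le[OF p, of 0 y 0] sublinear_zero[OF p] by simp
  moreover have "tilt p y 0 \<ge> 0" unfolding tilt_def
    by (rule cINF_greatest) (use sublinear_scale[OF p] in auto)
  ultimately show "tilt p y 0 = 0" by simp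
next
  fix s :: real and x assume s: "s > 0"
  show "tilt p y (s *\<^sub>R x) \<le> s * tilt p y x"
  proof (rule field_le_epsilon)
    fix d :: real assume "d > 0"
    obtain t where t: "t \<ge> 0" "p (x + t *\<^sub>R y) - t * p y < tilt p y x + d / s"
      by (rule tilt_less[OF p, of y x "tilt p y x + d / s"]) (use \<open>d > 0\<close> s in auto)
    have "tilt p y (s *\<^sub>R x) \<le> p (s *\<^sub>R x + (s * t) *\<^sub>R y) - (s * t) * p y"
      using t s by (intro tilt_le[OF p]) simp
    also have "p (s *\<^sub>R x + (s * t) *\<^sub>R y) = s * p (x + t *\<^sub>R y)"
      using sublinear_scale[OF p, of s "x + t *\<^sub>R y"] s by (simp add: algebra_simps)
    also have "s * p (x + t *\<^sub>R y) - s * t * p y = s * (p (x + t *\<^sub>R y) - t * p y)"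
      by (simp add: algebra_simps)
    also have "\<dots> \<le> s * (tilt p y x + d / s)" using t s by (intro mult_left_mono) auto
    finally show "tilt p y (s *\<^sub>R x) \<le> s * tilt p y x + d" using s by (simp add: algebra_simps)
  qed
qed

lemma minimal_sublinear:
  assumes p: "sublinear p"
  obtains s where "sublinear s" "\<And>x. s x \<le> p x"
    "\<And>s'. sublinear s' \<Longrightarrow> (\<And>x. s' x \<le> s x) \<Longrightarrow> s' = s"
proof -
  define S where "S = {s. sublinear s \<and> s \<le> p}"
  have "\<exists>s\<in>S. \<forall>a\<in>S. s \<ge> a \<longrightarrow> a = s"
  proof (rule predicate_Zorn)
    show "partial_order_on S (relation_of (\<lambda>f g. f \<ge> g) S)"
      by (rule partial_order_on_relation_ofI) auto
    fix C assume C: "C \<in> Chains (relation_of (\<lambda>f g. f \<ge> g) S)"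
    then have CS: "C \<subseteq> S" and chain: "\<And>f g. f \<in> C \<Longrightarrow> g \<in> C \<Longrightarrow> f \<le> g \<or> g \<le> f"
      by (auto simp: Chains_def relation_of_def)
    show "\<exists>u\<in>S. \<forall>a\<in>C. a \<ge> u"
    proof (cases "C = {}")
      case True then show ?thesis using p by (auto simp: S_def)
    next
      case False
      have sub: "sublinear f" "f x \<le> p x" if "f \<in> C" for f x
        using CS that by (auto simp: S_def le_fun_def)
      define u where "u x = (INF f\<in>C. f x)" for x
      have bdd: "bdd_below ((\<lambda>f. f x) ` C)" for x
      proof (rule bdd_belowI2)
        fix f assume "f \<in> C"
        show "- p (- x) \<le> f x"
          using sublinear_minus[OF sub(1)[OF \<open>f \<in> C\<close>], of x] sub(2)[OF \<open>f \<in> C\<close>, of "- x"] by linarith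
      qed
      have u_le: "u x \<le> f x" if "f \<in> C" for f x
        unfolding u_def by (rule cINF_lower[OF bdd that])
      have u_less: "\<exists>f\<in>C. f x < c" if "u x < c" for x c
        using that cINF_less_iff[OF False bdd, of x c] unfolding u_def by auto
      have "sublinear u"
      proof (rule sublinearI)
        fix x y
        show "u (x + y) \<le> u x + u y"
        proof (rule field_le_epsilon)
          fix d :: real assume "d > 0"
          then obtain f g where f: "f \<in> C" "f x < u x + d / 2" and g: "g \<in> C" "g y < u y + d / 2"
            using u_less[of x "u x + d / 2"] u_less[of y "u y + d / 2"] by auto
          obtain h where h: "h \<in> C" "h \<le> f" "h \<le> g" using chain[OF f(1) g(1)] f g by blast
          have "u (x + y) \<le> h x + h y"
            using u_le[OF h(1), of "x + y"] sublinear_add[OF sub(1)[OF h(1)], of x y] by linarith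
          moreover have "h x \<le> f x" "h y \<le> g y" using h by (auto simp: le_fun_def)
          ultimately show "u (x + y) \<le> u x + u y + d" using f g by linarith
        qed
      next
        have "u 0 = (INF f\<in>C. 0)" unfolding u_def
          by (rule INF_cong) (use sublinear_zero[OF sub(1)] in auto)
        then show "u 0 = 0" using False by simp
      next
        fix t :: real and x assume t: "t > 0"
        show "u (t *\<^sub>R x) \<le> t * u x"
        proof (rule field_le_epsilon)
          fix d :: real assume "d > 0"
          then obtain f where f: "f \<in> C" "f x < u x + d / t"
            using u_less[of x "u x + d / t"] t by auto
          have "u (t *\<^sub>R x) \<le> t * f x"
            using u_le[OF f(1), of "t *\<^sub>R x"] sublinear_scale[OF sub(1)[OF f(1)], of t x] t by simp
          also have "\<dots> \<le> t * (u x + d / t)" using f t by (intro mult_left_mono) auto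
          finally show "u (t *\<^sub>R x) \<le> t * u x + d" using t by (simp add: algebra_simps)
        qed
      qed
      moreover have "u \<le> p" using False u_le sub(2) by (fastforce simp: le_fun_def intro: order_trans)
      ultimately show ?thesis using u_le by (auto simp: S_def le_fun_def)
    qed
  qed
  then obtain s where "s \<in> S" and min: "\<And>a. a \<in> S \<Longrightarrow> a \<le> s \<Longrightarrow> a = s" by blast
  show ?thesis
  proof (rule that[of s])
    show "sublinear s" "\<And>x. s x \<le> p x" using \<open>s \<in> S\<close> by (auto simp: S_def le_fun_def)
    show "s' = s" if "sublinear s'" "\<And>x. s' x \<le> s x" for s'
      by (rule min) (use that \<open>s \<in> S\<close> in \<open>auto simp: S_def le_fun_def intro: order_trans\<close>)
  qed
qed

text \<open>
  Zorn's lemma is applied to sublinear functionals on the whole space instead of to linear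
  functionals on growing subspaces: a minimal sublinear functional is linear, so no partial
  functional has to be extended.
\<close>

lemma hahn_banach_sublinear:
  assumes p: "sublinear p"
  obtains f where "linear f" "\<And>x. f x \<le> p x" "f w = p w"
proof -
  obtain s where s: "sublinear s" and le: "\<And>x. s x \<le> tilt p w x"
    and min: "\<And>s'. sublinear s' \<Longrightarrow> (\<And>x. s' x \<le> s x) \<Longrightarrow> s' = s"
    using minimal_sublinear[OF tilt_sublinear[OF p, of w]] by metis
  have super: "s x + s y \<le> s (x + y)" for x y
  proof -
    have "tilt s y = s"
      by (rule min[OF tilt_sublinear[OF s]]) (use tilt_le[OF s, of 0 y] in simp)
    then show ?thesis using tilt_le[OF s, of 1 y x] by simp
  qed
  have add: "s (x + y) = s x + s y" for x y
    using super[of x y] sublinear_add[OF s, of x y] by simp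
  have neg: "s (- x) = - s x" for x
    using add[of x "- x"] sublinear_zero[OF s] by simp
  have "linear s"
  proof (rule linearI)
    fix r x show "s (r *\<^sub>R x) = r *\<^sub>R s x"
      using sublinear_scale[OF s, of r x] sublinear_scale[OF s, of "- r" x] neg[of "r *\<^sub>R x"]
      by (cases "r \<ge> 0") auto
  qed (rule add)
  moreover have sp: "s x \<le> p x" for x
    using le[of x] tilt_le[OF p, of 0 w x] by simp
  moreover have "s w = p w"
    using le[of "- w"] tilt_le[OF p, of 1 w "- w"] sublinear_zero[OF p] neg[of w] sp[of w] by simp
  ultimately show ?thesis using that by blast
qed

section \<open>Cohen factorization\<close>

text \<open>
  The constant \<open>C\<close> bounds the inverse of \<open>T\<close>. Only subtractivity of \<open>T\<close> is recorded, since that is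
  the form in which linearity enters contraction estimates.
\<close>

definition invertible_on :: "'b::real_normed_vector set \<Rightarrow> ('b \<Rightarrow> 'b) \<Rightarrow> real \<Rightarrow> bool" where
  "invertible_on Y T C \<longleftrightarrow> C > 0 \<and> (\<forall>v\<in>Y. T v \<in> Y) \<and> (\<forall>u\<in>Y. \<forall>v\<in>Y. T (u - v) = T u - T v) \<and>
     (\<forall>w\<in>Y. \<exists>v\<in>Y. T v = w) \<and> (\<forall>v\<in>Y. norm v \<le> C * norm (T v))"

lemma invertible_on_comp:
  assumes S: "invertible_on Y S C" and T: "invertible_on Y T C'"
  shows "invertible_on Y (\<lambda>v. S (T v)) (C' * C)"
proof -
  have "norm v \<le> C' * C * norm (S (T v))" if "v \<in> Y" for v
  proof -
    have "norm v \<le> C' * norm (T v)" using T that by (simp add: invertible_on_def)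
    also have "\<dots> \<le> C' * (C * norm (S (T v)))"
      using S T that by (intro mult_left_mono) (auto simp: invertible_on_def)
    finally show ?thesis by simp
  qed
  moreover have "\<exists>v\<in>Y. S (T v) = w" if "w \<in> Y" for w
    using S T that unfolding invertible_on_def by metis
  ultimately show ?thesis
    using S T unfolding invertible_on_def by simp
qed

lemma invertible_on_perturb:
  assumes Y: "subspace Y" "complete Y" and T: "invertible_on Y T C"
    and S: "\<And>v. v \<in> Y \<Longrightarrow> S v \<in> Y" "\<And>u v. u \<in> Y \<Longrightarrow> v \<in> Y \<Longrightarrow> S (u - v) = S u - S v"
    and near: "\<And>v. v \<in> Y \<Longrightarrow> C * norm (S v - T v) \<le> norm v / 2"
  shows "invertible_on Y S (2 * C)"
proof -
  have C: "C > 0" and TY: "\<And>v. v \<in> Y \<Longrightarrow> T v \<in> Y"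
    and Td: "\<And>u v. u \<in> Y \<Longrightarrow> v \<in> Y \<Longrightarrow> T (u - v) = T u - T v"
    and Ts: "\<And>w. w \<in> Y \<Longrightarrow> \<exists>v\<in>Y. T v = w" and Tn: "\<And>v. v \<in> Y \<Longrightarrow> norm v \<le> C * norm (T v)"
    using T by (auto simp: invertible_on_def)
  note diff = subspace_diff[OF Y(1)]
  obtain R where R: "\<And>w. w \<in> Y \<Longrightarrow> R w \<in> Y \<and> T (R w) = w" using Ts by metis
  have "\<exists>v\<in>Y. S v = w" if w: "w \<in> Y" for w
  proof -
    \<comment> \<open>A solution is a fixed point of the contraction \<open>v \<mapsto> T\<^sup>-\<^sup>1 (w - (S - T) v)\<close>.\<close>
    let ?g = "\<lambda>v. R (w - (S v - T v))"
    have gY: "w - (S v - T v) \<in> Y" if "v \<in> Y" for v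
      by (intro diff w S(1) TY that)
    have "\<exists>!v\<in>Y. ?g v = v"
    proof (rule Banach_fix[OF Y(2), of "1/2"])
      show "Y \<noteq> {}" using w by blast
      show "?g ` Y \<subseteq> Y" using R gY by blast
      show "dist (?g u) (?g v) \<le> 1/2 * dist u v" if "u \<in> Y" "v \<in> Y" for u v
      proof -
        have uv: "u \<in> Y" "v \<in> Y" "u - v \<in> Y" using that diff[of u v] by auto
        note g = R[OF gY[OF uv(1)]] R[OF gY[OF uv(2)]]
        have "T (?g u - ?g v) = - (S (u - v) - T (u - v))"
          using g uv(1,2) by (simp add: Td S(2))
        then have "norm (?g u - ?g v) \<le> C * norm (S (u - v) - T (u - v))"
          using Tn[OF diff[OF conjunct1[OF g(1)] conjunct1[OF g(2)]]] by (simp only: norm_minus_cancel)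
        also have "\<dots> \<le> norm (u - v) / 2" by (rule near[OF uv(3)])
        finally show ?thesis by (simp add: dist_norm)
      qed
    qed auto
    then obtain v where v: "v \<in> Y" "?g v = v" by blast
    have "T v = w - (S v - T v)" using R[OF gY[OF v(1)]] v(2) by simp
    then show ?thesis using v(1) by auto
  qed
  moreover have "norm v \<le> 2 * C * norm (S v)" if v: "v \<in> Y" for v
  proof -
    have "norm v \<le> C * norm (S v - (S v - T v))" using Tn[OF v] by simp
    also have "\<dots> \<le> C * norm (S v) + C * norm (S v - T v)"
      using C norm_triangle_ineq4[of "S v" "S v - T v"] by (simp flip: distrib_left)
    finally show ?thesis using near[OF v] by simp
  qed
  ultimately show ?thesis using C S by (simp add: invertible_on_def)
qed

lemma Cauchy_geometric:
  fixes x :: "nat \<Rightarrow> 'a::real_normed_vector"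
  assumes r: "0 \<le> r" "r < 1" and step: "\<And>n. norm (x (Suc n) - x n) \<le> K * r ^ n"
  shows "Cauchy x"
proof -
  define s where "s n = (\<Sum>i<n. K * r ^ i)" for n
  have "summable (\<lambda>i. K * r ^ i)" using r by (intro summable_mult summable_geometric) auto
  then have "convergent s" unfolding s_def by (simp only: summable_iff_convergent)
  then have "Cauchy s" by (rule convergent_Cauchy)
  have le: "norm (x n - x m) \<le> s n - s m" if "m \<le> n" for m n
    using that
  proof (induction n rule: dec_induct)
    case (step n)
    have "norm (x (Suc n) - x m) \<le> norm (x (Suc n) - x n) + norm (x n - x m)"
      using norm_triangle_ineq[of "x (Suc n) - x n" "x n - x m"] by simp
    with step assms(3)[of n] show ?case by (simp add: s_def)
  qed simp
  have "dist (x m) (x n) \<le> dist (s m) (s n)" for m n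
    using le[of m n] le[of n m] by (cases "m \<le> n") (auto simp: dist_norm norm_minus_commute)
  with \<open>Cauchy s\<close> show ?thesis unfolding Cauchy_def by (meson le_less_trans)
qed

text \<open>
  Cohen's factorization with approximate units \<open>x\<close> that act on the right of the algebra
  (\<open>P a x \<approx> a\<close>) and on the left of the module (\<open>D x z \<approx> z\<close>). One builds operators
  \<open>T\<^sub>n v = D (b\<^sub>n) v + (1 - c)\<^sup>n v\<close> and vectors \<open>z\<^sub>n\<close> with \<open>T\<^sub>n z\<^sub>n = y\<close>, where
  \<open>b\<^sub>n\<^sub>+\<^sub>1 = b\<^sub>n + c (1 - c)\<^sup>n e\<close> for an approximate unit \<open>e\<close>. With \<open>E v = (1 - c) v + c (D e v)\<close>,
  the operator \<open>T\<^sub>n\<^sub>+\<^sub>1\<close> differs from \<open>T\<^sub>n \<circ> E\<close> by \<open>c D (b\<^sub>n - P b\<^sub>n e)\<close>, which is as small as one likes;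
  this makes it invertible with a bound for the inverse that is known before \<open>e\<close> is chosen. Hence
  \<open>z\<^sub>n\<^sub>+\<^sub>1 - z\<^sub>n = T\<^sub>n\<^sub>+\<^sub>1\<^sup>-\<^sup>1 (c (1 - c)\<^sup>n (z\<^sub>n - D e z\<^sub>n))\<close> can be made small by the choice of \<open>e\<close> as well,
  and both sequences converge. In the limit the scalar part of \<open>T\<^sub>n\<close> disappears.
\<close>

lemma cohen_factorization:
  fixes X :: "'a::real_normed_vector set" and Y :: "'b::real_normed_vector set"
    and P :: "'a \<Rightarrow> 'a \<Rightarrow> 'a" and D :: "'a \<Rightarrow> 'b \<Rightarrow> 'b"
  assumes X: "subspace X" "complete X" and Y: "subspace Y" "complete Y"
    and PX: "\<And>x x'. x \<in> X \<Longrightarrow> x' \<in> X \<Longrightarrow> P x x' \<in> X"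
    and DY: "\<And>x y. x \<in> X \<Longrightarrow> y \<in> Y \<Longrightarrow> D x y \<in> Y"
    and D_add_left: "\<And>x x' y. x \<in> X \<Longrightarrow> x' \<in> X \<Longrightarrow> y \<in> Y \<Longrightarrow> D (x + x') y = D x y + D x' y"
    and D_add_right: "\<And>x y y'. x \<in> X \<Longrightarrow> y \<in> Y \<Longrightarrow> y' \<in> Y \<Longrightarrow> D x (y + y') = D x y + D x y'"
    and D_scale_left: "\<And>r x y. x \<in> X \<Longrightarrow> y \<in> Y \<Longrightarrow> D (r *\<^sub>R x) y = r *\<^sub>R D x y"
    and D_scale_right: "\<And>r x y. x \<in> X \<Longrightarrow> y \<in> Y \<Longrightarrow> D x (r *\<^sub>R y) = r *\<^sub>R D x y"
    and D_bound: "\<And>x y. x \<in> X \<Longrightarrow> y \<in> Y \<Longrightarrow> norm (D x y) \<le> K * norm x * norm y"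
    and assoc: "\<And>a x y. a \<in> X \<Longrightarrow> x \<in> X \<Longrightarrow> y \<in> Y \<Longrightarrow> D (P a x) y = D a (D x y)"
    and approx: "\<And>a z \<epsilon>. a \<in> X \<Longrightarrow> z \<in> Y \<Longrightarrow> \<epsilon> > 0 \<Longrightarrow>
      \<exists>x\<in>X. norm x \<le> M \<and> norm (P a x - a) < \<epsilon> \<and> norm (D x z - z) < \<epsilon>"
    and KM: "K \<ge> 0" "M \<ge> 0" and y: "y \<in> Y"
  obtains a z where "a \<in> X" "z \<in> Y" "D a z = y"
proof -
  note Xc = subspace_add[OF X(1)] subspace_diff[OF X(1)] subspace_scale[OF X(1)] subspace_0[OF X(1)]
  note Yc = subspace_add[OF Y(1)] subspace_diff[OF Y(1)] subspace_scale[OF Y(1)] subspace_0[OF Y(1)]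
  have D_diff_left: "D (x - x') y = D x y - D x' y" if "x \<in> X" "x' \<in> X" "y \<in> Y" for x x' y
    using D_add_left[of "x - x'" x' y] that Xc by (simp add: algebra_simps)
  have D_diff_right: "D x (y - y') = D x y - D x y'" if "x \<in> X" "y \<in> Y" "y' \<in> Y" for x y y'
    using D_add_right[of x "y - y'" y'] that Yc by (simp add: algebra_simps)
  \<comment> \<open>So small that \<open>E v = (1 - c) v + c (D e v)\<close> moves \<open>v\<close> by at most \<open>norm v / 2\<close>.\<close>
  define c where "c = 1 / (2 * (K * M + 1))"
  have KM0: "K * M \<ge> 0" using KM by simp
  have c: "0 < c" "c \<le> 1/2" "c * (K * M + 1) = 1/2"
    using KM0 by (auto simp: c_def field_simps)
  let ?T = "\<lambda>b t v. D b v + t *\<^sub>R v"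
  have step: "\<exists>b' z' C'. b' \<in> X \<and> z' \<in> Y \<and> invertible_on Y (?T b' ((1 - c) * t)) C' \<and>
      ?T b' ((1 - c) * t) z' = y \<and> norm (b' - b) \<le> c * M * t \<and> norm (z' - z) \<le> d"
    if b: "b \<in> X" and z: "z \<in> Y" and inv: "invertible_on Y (?T b t) C"
      and Tz: "?T b t z = y" and t: "t > 0" and d: "d > 0" for b z C t d
  proof -
    have C: "C > 0" using inv by (simp add: invertible_on_def)
    \<comment> \<open>The first bound keeps \<open>T'\<close> within the perturbation radius \<open>1 / (4 * C)\<close> of \<open>T \<circ> E\<close>,
      the second one gives \<open>norm (z' - z) \<le> d\<close>; \<open>K + 1\<close> avoids a division by zero.\<close>
    define \<epsilon> where "\<epsilon> = min (1 / (4 * C * c * (K + 1))) (d / (4 * C * c * t))"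
    have "\<epsilon> > 0" using C c KM t d by (simp add: \<epsilon>_def add_nonneg_pos)
    then obtain e where e: "e \<in> X" "norm e \<le> M" "norm (P b e - b) < \<epsilon>" "norm (D e z - z) < \<epsilon>"
      using approx[OF b z] by blast
    define b' where "b' = b + (c * t) *\<^sub>R e"
    have b': "b' \<in> X" using b e Xc by (simp add: b'_def)
    let ?E = "\<lambda>v. (1 - c) *\<^sub>R v + c *\<^sub>R D e v"
    have Db': "D b' v = D b v + (c * t) *\<^sub>R D e v" if "v \<in> Y" for v
      using that b e Xc by (simp add: b'_def D_add_left D_scale_left)
    have E: "invertible_on Y ?E (2 * 1)"
    proof (rule invertible_on_perturb[OF Y, of "\<lambda>v. v"])
      show "invertible_on Y (\<lambda>v. v) 1" by (simp add: invertible_on_def)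
      fix v assume v: "v \<in> Y"
      show "?E v \<in> Y" using v e DY Yc by simp
      have "norm (D e v) \<le> K * M * norm v"
        using D_bound[OF e(1) v] e(2) KM
        by (meson mult_left_mono mult_right_mono norm_ge_zero order_trans)
      then have "norm (D e v - v) \<le> (K * M + 1) * norm v"
        using norm_triangle_ineq4[of "D e v" v] by (simp add: algebra_simps)
      then have "c * norm (D e v - v) \<le> c * ((K * M + 1) * norm v)"
        using c(1) by (intro mult_left_mono) auto
      also have "\<dots> = norm v / 2" using c(3) by (metis mult.assoc mult.left_neutral times_divide_eq_left)
      finally have "c * norm (D e v - v) \<le> norm v / 2" .
      moreover have "?E v - v = c *\<^sub>R (D e v - v)" by (simp add: algebra_simps)
      ultimately show "1 * norm (?E v - v) \<le> norm v / 2" using c(1) by simp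
    qed (simp add: D_diff_right e(1) algebra_simps)
    have "invertible_on Y (\<lambda>v. ?T b t (?E v)) (2 * 1 * C)" by (rule invertible_on_comp[OF inv E])
    then have TE: "invertible_on Y (\<lambda>v. ?T b t (?E v)) (2 * C)" by simp
    have inv': "invertible_on Y (?T b' ((1 - c) * t)) (2 * (2 * C))"
    proof (rule invertible_on_perturb[OF Y TE])
      fix v assume v: "v \<in> Y"
      show "?T b' ((1 - c) * t) v \<in> Y" using v b' DY Yc by simp
      have De: "D e v \<in> Y" using v e DY by simp
      have "D b (?E v) = (1 - c) *\<^sub>R D b v + c *\<^sub>R D b (D e v)"
        using v b De Yc(3) by (simp add: D_add_right D_scale_right)
      then have "?T b' ((1 - c) * t) v - ?T b t (?E v) = c *\<^sub>R (D b v - D b (D e v))"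
        by (simp add: Db'[OF v] algebra_simps)
      also have "D b v - D b (D e v) = D (b - P b e) v"
        by (simp add: D_diff_left assoc v b e(1) PX)
      finally have *: "norm (?T b' ((1 - c) * t) v - ?T b t (?E v)) = c * norm (D (b - P b e) v)"
        using c by simp
      have "norm (D (b - P b e) v) \<le> K * norm (b - P b e) * norm v"
        by (rule D_bound) (simp_all add: b e(1) PX Xc(2) v)
      also have "\<dots> \<le> (K + 1) * \<epsilon> * norm v"
        using e(3) KM by (intro mult_right_mono mult_mono) (auto simp: norm_minus_commute)
      also have "\<dots> \<le> (K + 1) * (1 / (4 * C * c * (K + 1))) * norm v"
        using KM by (intro mult_right_mono mult_left_mono) (auto simp: \<epsilon>_def)
      also have "\<dots> = 1 / (4 * C * c) * norm v" using KM C c by (simp add: field_simps add_nonneg_eq_0_iff)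
      finally have "2 * C * (c * norm (D (b - P b e) v)) \<le> 2 * C * (c * (1 / (4 * C * c) * norm v))"
        using C c by (intro mult_left_mono) auto
      also have "\<dots> = norm v / 2" using C c by (simp add: field_simps)
      finally show "2 * C * norm (?T b' ((1 - c) * t) v - ?T b t (?E v)) \<le> norm v / 2"
        using * by simp
    qed (simp add: D_diff_right b' algebra_simps)
    then obtain z' where z': "z' \<in> Y" "?T b' ((1 - c) * t) z' = y"
      using y unfolding invertible_on_def by blast
    have "?T b' ((1 - c) * t) (z' - z) = ?T b' ((1 - c) * t) z' - ?T b' ((1 - c) * t) z"
      using z z' b' by (simp add: D_diff_right algebra_simps)
    also have "\<dots> = - ((c * t) *\<^sub>R (D e z - z))"
      using z'(2) Tz Db'[OF z] by (simp add: algebra_simps)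
    finally have "norm (?T b' ((1 - c) * t) (z' - z)) = c * t * norm (D e z - z)" using c t by simp
    then have "norm (z' - z) \<le> 2 * (2 * C) * (c * t * norm (D e z - z))"
      using inv' Yc(2)[OF z'(1) z] unfolding invertible_on_def by metis
    also have "\<dots> \<le> 2 * (2 * C) * (c * t * (d / (4 * C * c * t)))"
      using e(4) C c t by (intro mult_left_mono) (auto simp: \<epsilon>_def)
    also have "\<dots> = d" using C c t by (simp add: field_simps)
    finally have "norm (z' - z) \<le> d" .
    moreover have "norm (b' - b) \<le> c * M * t" using e(2) c t by (simp add: b'_def mult.commute mult.left_commute)
    ultimately show ?thesis using b' z' inv' by blast
  qed
  define Q where "Q n s \<longleftrightarrow> (case s of (b, z, C) \<Rightarrow> b \<in> X \<and> z \<in> Y \<and>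
      invertible_on Y (?T b ((1 - c) ^ n)) C \<and> ?T b ((1 - c) ^ n) z = y)" for n s
  have "\<exists>f. \<forall>n. Q n (f n) \<and>
      norm (fst (f (Suc n)) - fst (f n)) \<le> c * M * (1 - c) ^ n \<and>
      norm (fst (snd (f (Suc n))) - fst (snd (f n))) \<le> (1/2) ^ n"
  proof (rule dependent_nat_choice)
    have D0: "D 0 v = 0" if "v \<in> Y" for v using D_scale_left[of 0 v 0] that Xc(4) by simp
    have "Q 0 (0, y, 1)" by (simp add: Q_def invertible_on_def D0 y Xc(4) Yc(2))
    then show "\<exists>s. Q 0 s" ..
  next
    fix s n assume Qs: "Q n s"
    obtain b z C where s: "s = (b, z, C)" by (cases s)
    have "b \<in> X" "z \<in> Y" "invertible_on Y (?T b ((1 - c) ^ n)) C" "?T b ((1 - c) ^ n) z = y"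
      using Qs by (simp_all add: Q_def s)
    moreover have "(1 - c) ^ n > 0" "(1/2 :: real) ^ n > 0" using c by simp_all
    ultimately obtain b' z' C' where "b' \<in> X" "z' \<in> Y"
      "invertible_on Y (?T b' ((1 - c) * (1 - c) ^ n)) C'" "?T b' ((1 - c) * (1 - c) ^ n) z' = y"
      and bz': "norm (b' - b) \<le> c * M * (1 - c) ^ n" "norm (z' - z) \<le> (1/2) ^ n"
      using step[of b z "(1 - c) ^ n" C "(1/2) ^ n"] by blast
    then have "Q (Suc n) (b', z', C')" by (simp add: Q_def)
    with bz' s show "\<exists>s'. Q (Suc n) s' \<and> norm (fst s' - fst s) \<le> c * M * (1 - c) ^ n \<and>
        norm (fst (snd s') - fst (snd s)) \<le> (1/2) ^ n"
      by (intro exI[of _ "(b', z', C')"]) simp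
  qed
  then obtain f where f: "\<And>n. Q n (f n)"
    "\<And>n. norm (fst (f (Suc n)) - fst (f n)) \<le> c * M * (1 - c) ^ n"
    "\<And>n. norm (fst (snd (f (Suc n))) - fst (snd (f n))) \<le> (1/2) ^ n" by blast
  define b where "b n = fst (f n)" for n
  define z where "z n = fst (snd (f n))" for n
  have bz: "b n \<in> X" "z n \<in> Y" "D (b n) (z n) + (1 - c) ^ n *\<^sub>R z n = y" for n
    using f(1)[of n] by (auto simp: Q_def b_def z_def split: prod.splits)
  have "Cauchy b"
    by (rule Cauchy_geometric[of "1 - c" _ "c * M"]) (use c f(2) in \<open>auto simp: b_def\<close>)
  then obtain a where a: "a \<in> X" "b \<longlonglongrightarrow> a"
    using X(2) bz(1) unfolding complete_def by blast
  have "Cauchy z"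
    by (rule Cauchy_geometric[of "1/2" _ 1]) (use f(3) in \<open>auto simp: z_def\<close>)
  then obtain w where w: "w \<in> Y" "z \<longlonglongrightarrow> w"
    using Y(2) bz(2) unfolding complete_def by blast
  have t0: "(\<lambda>n. (1 - c) ^ n) \<longlonglongrightarrow> 0" using c by (intro LIMSEQ_realpow_zero) auto
  have lim1: "(\<lambda>n. (1 - c) ^ n *\<^sub>R z n) \<longlonglongrightarrow> 0"
    using tendsto_scaleR[OF t0 w(2)] by simp
  have "(\<lambda>n. D (b n) (z n) - D a w) \<longlonglongrightarrow> 0"
  proof (rule Lim_null_comparison)
    show "\<forall>\<^sub>F n in sequentially. norm (D (b n) (z n) - D a w) \<le>
        K * norm (b n - a) * norm (z n) + K * norm a * norm (z n - w)"
    proof (rule always_eventually, rule allI)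
      fix n
      have "D (b n) (z n) - D a w = D (b n - a) (z n) + D a (z n - w)"
        using bz a w by (simp add: D_diff_left D_diff_right)
      also have "norm \<dots> \<le> K * norm (b n - a) * norm (z n) + K * norm a * norm (z n - w)"
        using bz[of n] a w Xc Yc by (intro norm_triangle_mono D_bound) auto
      finally show "norm (D (b n) (z n) - D a w) \<le>
        K * norm (b n - a) * norm (z n) + K * norm a * norm (z n - w)" .
    qed
    have 1: "(\<lambda>n. norm (b n - a)) \<longlonglongrightarrow> 0" "(\<lambda>n. norm (z n - w)) \<longlonglongrightarrow> 0"
      using a w LIM_zero tendsto_norm_zero by blast+
    show "(\<lambda>n. K * norm (b n - a) * norm (z n) + K * norm a * norm (z n - w)) \<longlonglongrightarrow> 0"
      by (rule tendsto_eq_intros 1 w(2) refl)+ simp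
  qed
  then have "(\<lambda>n. D (b n) (z n)) \<longlonglongrightarrow> D a w" by (simp add: LIM_zero_iff)
  from tendsto_add[OF this lim1] have "(\<lambda>n. y) \<longlonglongrightarrow> D a w" by (simp add: bz(3))
  then have "D a w = y" by (simp add: LIMSEQ_const_iff)
  with a w that show ?thesis by blast
qed

section \<open>The scalar field\<close>

text \<open>
  An element \<open>i\<close> that plays the imaginary unit for both scalar fields, being \<open>0\<close> for the reals.
  The estimates for the real and the imaginary part come from \<open>z * w = a\<^sup>2 + b\<^sup>2\<close> with
  \<open>w = a - b i\<close>: multiplicativity of the norm and \<open>norm w \<le> \<bar>a\<bar> + \<bar>b\<bar>\<close> yield
  \<open>\<bar>a\<bar> + \<bar>b\<bar> \<le> 2 * norm z\<close>, which is not sharp but enough for all uses.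
\<close>

lemma imaginary_unit:
  obtains i :: "'k::real_or_complex" where "i = 0 \<or> i * i = -1" "norm i \<le> 1"
    "\<And>z. \<exists>a b. z = of_real a + of_real b * i"
    "\<And>a b. \<bar>a\<bar> \<le> 2 * norm (of_real a + of_real b * i)"
    "\<And>a b. \<bar>b\<bar> * norm i \<le> 2 * norm (of_real a + of_real b * i)"
proof -
  obtain i :: 'k where i: "i = 0 \<or> i * i = -1" "\<And>z. \<exists>a b. z = a *\<^sub>R 1 + b *\<^sub>R i"
    using real_or_complex by blast
  have n: "norm i = 1" if "i * i = -1"
  proof -
    have "norm i * norm i = 1" using that by (metis norm_mult norm_minus_cancel norm_one)
    then show ?thesis by (metis norm_ge_zero real_sqrt_abs2 real_sqrt_one abs_of_nonneg)
  qed
  have le: "\<bar>a\<bar> + \<bar>b\<bar> \<le> 2 * norm (of_real a + of_real b * i)" if ii: "i * i = -1" for a b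
  proof (cases "a = 0 \<and> b = 0")
    case False
    let ?z = "of_real a + of_real b * i" and ?w = "of_real a - of_real b * i" and ?s = "\<bar>a\<bar> + \<bar>b\<bar>"
    have s: "?s > 0" using False by linarith
    have "?z * ?w = of_real (a * a) - of_real (b * b) * (i * i)" by (simp add: algebra_simps)
    also have "\<dots> = of_real (a * a + b * b)" by (simp add: ii)
    finally have "norm ?z * norm ?w = norm (of_real (a * a + b * b) :: 'k)" by (metis norm_mult)
    then have zw: "norm ?z * norm ?w = a * a + b * b"
      unfolding norm_of_real by simp
    have "norm ?w \<le> norm (of_real a :: 'k) + norm (of_real b * i)" by (rule norm_triangle_ineq4)
    then have "norm ?w \<le> ?s" by (simp add: norm_mult n[OF ii])
    then have "a * a + b * b \<le> norm ?z * ?s" unfolding zw[symmetric] by (intro mult_left_mono) auto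
    moreover have "?s * ?s \<le> 2 * (a * a + b * b)"
    proof -
      have "0 \<le> (\<bar>a\<bar> - \<bar>b\<bar>) * (\<bar>a\<bar> - \<bar>b\<bar>)" by simp
      also have "\<dots> = 2 * (\<bar>a\<bar> * \<bar>a\<bar> + \<bar>b\<bar> * \<bar>b\<bar>) - ?s * ?s" by (simp add: algebra_simps)
      finally show ?thesis by simp
    qed
    ultimately have "?s * ?s \<le> (2 * norm ?z) * ?s" by simp
    with s show ?thesis by (simp only: mult_le_cancel_right)
  qed simp
  show ?thesis
  proof (rule that[of i])
    show "\<exists>a b. z = of_real a + of_real b * i" for z
      using i(2)[of z] by (simp add: scaleR_conv_of_real)
    show "\<bar>a\<bar> \<le> 2 * norm (of_real a + of_real b * i)" for a b
      using i(1) le[of a b] by auto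
    show "\<bar>b\<bar> * norm i \<le> 2 * norm (of_real a + of_real b * i)" for a b
      using i(1) le[of a b] n by auto
    show "i = 0 \<or> i * i = -1" "norm i \<le> 1" using i(1) n by auto
  qed
qed

lemma complete_scalars: "complete (UNIV :: 'k::real_or_complex set)"
proof (rule completeI)
  fix f :: "nat \<Rightarrow> 'k" assume f: "Cauchy f"
  obtain i :: 'k where rep: "\<And>z. \<exists>a b. z = of_real a + of_real b * i"
    and le: "\<And>a b. \<bar>a\<bar> \<le> 2 * norm (of_real a + of_real b * i)"
      "\<And>a b. \<bar>b\<bar> * norm i \<le> 2 * norm (of_real a + of_real b * i)"
    by (rule imaginary_unit) (rule that, assumption+)
  have "\<forall>n. \<exists>a b. f n = of_real a + of_real b * i" using rep by blast
  then obtain a b where ab: "\<And>n. f n = of_real (a n) + of_real (b n) * i"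
    unfolding choice_iff by blast
  have diff: "f m - f n = of_real (a m - a n) + of_real (b m - b n) * i" for m n
    by (simp add: ab algebra_simps)
  have half: "norm x < e" if "norm x \<le> 2 * norm y" "norm y < e / 2" for x :: real and y :: 'k and e
    using that by linarith
  have "Cauchy a"
    unfolding Cauchy_iff
  proof (intro allI impI)
    fix e :: real assume "e > 0"
    then obtain N where "\<And>m n. m \<ge> N \<Longrightarrow> n \<ge> N \<Longrightarrow> norm (f m - f n) < e / 2"
      using f unfolding Cauchy_iff by (meson half_gt_zero)
    moreover have le2: "norm (a m - a n) \<le> 2 * norm (f m - f n)" for m n
      using le(1)[of "a m - a n" "b m - b n"] unfolding diff by simp
    ultimately show "\<exists>M. \<forall>m\<ge>M. \<forall>n\<ge>M. norm (a m - a n) < e"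
      using half by meson
  qed
  then obtain a' where a': "a \<longlonglongrightarrow> a'" by (meson Cauchy_convergent convergent_def)
  have "Cauchy (\<lambda>n. b n * norm i)"
    unfolding Cauchy_iff
  proof (intro allI impI)
    fix e :: real assume "e > 0"
    then obtain N where "\<And>m n. m \<ge> N \<Longrightarrow> n \<ge> N \<Longrightarrow> norm (f m - f n) < e / 2"
      using f unfolding Cauchy_iff by (meson half_gt_zero)
    moreover have "norm (b m * norm i - b n * norm i) \<le> 2 * norm (f m - f n)" for m n
      using le(2)[of "b m - b n" "a m - a n"] unfolding diff
      by (simp add: abs_mult flip: left_diff_distrib)
    ultimately show "\<exists>M. \<forall>m\<ge>M. \<forall>n\<ge>M. norm (b m * norm i - b n * norm i) < e"
      using half by meson
  qed
  then obtain b' where b': "(\<lambda>n. b n * norm i) \<longlonglongrightarrow> b'" by (meson Cauchy_convergent convergent_def)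
  have "(\<lambda>n. of_real (b n) * i) \<longlonglongrightarrow> of_real (b' / norm i) * i"
  proof (cases "i = 0")
    case False
    then have "(\<lambda>n. b n) \<longlonglongrightarrow> b' / norm i"
      using tendsto_divide[OF b' tendsto_const, of "norm i"] by simp
    then show ?thesis by (intro tendsto_intros)
  qed simp
  from tendsto_add[OF tendsto_of_real[OF a'] this]
  have "f \<longlonglongrightarrow> of_real a' + of_real (b' / norm i) * i"
    by (simp flip: ab)
  then show "\<exists>l\<in>UNIV. f \<longlonglongrightarrow> l" by blast
qed

section \<open>Levels of a dual tower\<close>

definition space_at :: "('k::real_or_complex, 'u::real_normed_vector) dual_tower \<Rightarrow> nat \<Rightarrow> bool" where
  "space_at T k \<longleftrightarrow> normed_scaling (scal T) \<and> module.subspace (scal T) (lev T k)"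

definition dual_at :: "('k::real_or_complex, 'u::real_normed_vector) dual_tower \<Rightarrow> nat \<Rightarrow> bool" where
  "dual_at T k \<longleftrightarrow> space_at T k \<and> is_dual (scal T) (lev T k) (lev T (Suc k)) (pair T k)"

lemma normed_scaling_vector_space: "normed_scaling s \<Longrightarrow> vector_space s"
  and normed_scaling_of_real: "normed_scaling s \<Longrightarrow> s (of_real r) x = r *\<^sub>R x"
  and normed_scaling_norm: "normed_scaling s \<Longrightarrow> norm (s c x) = norm c * norm x"
  by (auto simp: normed_scaling_def)

lemma space_at_subspace:
  assumes "space_at T k"
  shows "0 \<in> lev T k" "x \<in> lev T k \<Longrightarrow> y \<in> lev T k \<Longrightarrow> x + y \<in> lev T k"
    "x \<in> lev T k \<Longrightarrow> scal T c x \<in> lev T k" "x \<in> lev T k \<Longrightarrow> r *\<^sub>R x \<in> lev T k"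
    "x \<in> lev T k \<Longrightarrow> y \<in> lev T k \<Longrightarrow> x - y \<in> lev T k" "x \<in> lev T k \<Longrightarrow> - x \<in> lev T k"
    "subspace (lev T k)"
proof -
  have s: "normed_scaling (scal T)" and sub: "module.subspace (scal T) (lev T k)"
    using assms by (auto simp: space_at_def)
  interpret vector_space "scal T" by (rule normed_scaling_vector_space[OF s])
  have R: "r *\<^sub>R x \<in> lev T k" if "x \<in> lev T k" for r x
    using subspace_scale[OF sub that, of "of_real r"] by (simp add: normed_scaling_of_real[OF s])
  show "real_vector.subspace (lev T k)"
    unfolding real_vector.subspace_def using sub R by (auto simp: subspace_def)
  show "0 \<in> lev T k" "x \<in> lev T k \<Longrightarrow> y \<in> lev T k \<Longrightarrow> x + y \<in> lev T k"
    "x \<in> lev T k \<Longrightarrow> scal T c x \<in> lev T k" "x \<in> lev T k \<Longrightarrow> r *\<^sub>R x \<in> lev T k"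
    "x \<in> lev T k \<Longrightarrow> y \<in> lev T k \<Longrightarrow> x - y \<in> lev T k" "x \<in> lev T k \<Longrightarrow> - x \<in> lev T k"
    using sub R subspace_diff[OF sub] subspace_neg[OF sub] by (auto simp: subspace_def)
qed

lemma scal_simps:
  assumes "space_at T k"
  shows "scal T (of_real r) x = r *\<^sub>R x" "norm (scal T c x) = norm c * norm x"
    "scal T c (x + y) = scal T c x + scal T c y" "scal T c (r *\<^sub>R x) = r *\<^sub>R scal T c x"
    "scal T (c + d) x = scal T c x + scal T d x" "scal T c (scal T d x) = scal T (c * d) x"
proof -
  have s: "normed_scaling (scal T)"
    using assms by (auto simp: space_at_def)
  interpret vector_space "scal T" by (rule normed_scaling_vector_space[OF s])
  have R: "scal T (of_real r) x = r *\<^sub>R x" for r x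
    by (rule normed_scaling_of_real[OF s])
  show "scal T (of_real r) x = r *\<^sub>R x" "norm (scal T c x) = norm c * norm x"
    by (simp_all add: R normed_scaling_norm[OF s])
  show "scal T c (r *\<^sub>R x) = r *\<^sub>R scal T c x"
    by (metis R scale_left_commute)
  show "scal T c (x + y) = scal T c x + scal T c y" "scal T (c + d) x = scal T c x + scal T d x"
    "scal T c (scal T d x) = scal T (c * d) x"
    by (simp_all add: scale_right_distrib scale_left_distrib)
qed

lemma dual_at_space: "dual_at T k \<Longrightarrow> space_at T k" "dual_at T k \<Longrightarrow> space_at T (Suc k)"
  by (auto simp: dual_at_def space_at_def is_dual_def)

lemma pair_simps:
  assumes "dual_at T k"
  shows "f \<in> lev T (Suc k) \<Longrightarrow> x \<in> lev T k \<Longrightarrow> y \<in> lev T k \<Longrightarrow> pair T k f (x + y) = pair T k f x + pair T k f y"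
    "f \<in> lev T (Suc k) \<Longrightarrow> x \<in> lev T k \<Longrightarrow> pair T k f (scal T c x) = c * pair T k f x"
    "f \<in> lev T (Suc k) \<Longrightarrow> x \<in> lev T k \<Longrightarrow> pair T k f (r *\<^sub>R x) = of_real r * pair T k f x"
    "f \<in> lev T (Suc k) \<Longrightarrow> g \<in> lev T (Suc k) \<Longrightarrow> x \<in> lev T k \<Longrightarrow> pair T k (f + g) x = pair T k f x + pair T k g x"
    "f \<in> lev T (Suc k) \<Longrightarrow> x \<in> lev T k \<Longrightarrow> pair T k (scal T c f) x = c * pair T k f x"
    "f \<in> lev T (Suc k) \<Longrightarrow> x \<in> lev T k \<Longrightarrow> pair T k (r *\<^sub>R f) x = of_real r * pair T k f x"
proof -
  have d: "is_dual (scal T) (lev T k) (lev T (Suc k)) (pair T k)" using assms by (simp add: dual_at_def)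
  show "f \<in> lev T (Suc k) \<Longrightarrow> x \<in> lev T k \<Longrightarrow> y \<in> lev T k \<Longrightarrow> pair T k f (x + y) = pair T k f x + pair T k f y"
    using d by (auto simp: is_dual_def bounded_functional_def)
  show 1: "f \<in> lev T (Suc k) \<Longrightarrow> x \<in> lev T k \<Longrightarrow> pair T k f (scal T c x) = c * pair T k f x" for c
    using d by (auto simp: is_dual_def bounded_functional_def)
  show 2: "f \<in> lev T (Suc k) \<Longrightarrow> x \<in> lev T k \<Longrightarrow> pair T k (scal T c f) x = c * pair T k f x" for c
    using d by (auto simp: is_dual_def)
  show "f \<in> lev T (Suc k) \<Longrightarrow> g \<in> lev T (Suc k) \<Longrightarrow> x \<in> lev T k \<Longrightarrow> pair T k (f + g) x = pair T k f x + pair T k g x"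
    using d by (auto simp: is_dual_def)
  show "f \<in> lev T (Suc k) \<Longrightarrow> x \<in> lev T k \<Longrightarrow> pair T k f (r *\<^sub>R x) = of_real r * pair T k f x"
    using 1[of "of_real r"] by (simp add: scal_simps(1)[OF dual_at_space(1)[OF assms]])
  show "f \<in> lev T (Suc k) \<Longrightarrow> x \<in> lev T k \<Longrightarrow> pair T k (r *\<^sub>R f) x = of_real r * pair T k f x"
    using 2[of "of_real r"] by (simp add: scal_simps(1)[OF dual_at_space(1)[OF assms]])
qed

lemma pair_diff:
  assumes "dual_at T k"
  shows "f \<in> lev T (Suc k) \<Longrightarrow> x \<in> lev T k \<Longrightarrow> y \<in> lev T k \<Longrightarrow> pair T k f (x - y) = pair T k f x - pair T k f y"
    "f \<in> lev T (Suc k) \<Longrightarrow> g \<in> lev T (Suc k) \<Longrightarrow> x \<in> lev T k \<Longrightarrow> pair T k (f - g) x = pair T k f x - pair T k g x"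
proof -
  note s = space_at_subspace(5)[OF dual_at_space(1)[OF assms]] space_at_subspace(5)[OF dual_at_space(2)[OF assms]]
  show "f \<in> lev T (Suc k) \<Longrightarrow> x \<in> lev T k \<Longrightarrow> y \<in> lev T k \<Longrightarrow> pair T k f (x - y) = pair T k f x - pair T k f y"
    using pair_simps(1)[OF assms, of f "x - y" y] s(1) by simp
  show "f \<in> lev T (Suc k) \<Longrightarrow> g \<in> lev T (Suc k) \<Longrightarrow> x \<in> lev T k \<Longrightarrow> pair T k (f - g) x = pair T k f x - pair T k g x"
    using pair_simps(4)[OF assms, of "f - g" g x] s(2) by simp
qed

lemma pair_bound:
  assumes d: "dual_at T k" and f: "f \<in> lev T (Suc k)" and x: "x \<in> lev T k"
  shows "norm (pair T k f x) \<le> norm f * norm x"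
proof (cases "x = 0")
  case True
  then show ?thesis using pair_simps(3)[OF d f x, of 0] by simp
next
  case False
  have isd: "is_dual (scal T) (lev T k) (lev T (Suc k)) (pair T k)" using d by (simp add: dual_at_def)
  have "bounded_functional (scal T) (lev T k) (pair T k f)"
    using isd f by (simp add: is_dual_def)
  then obtain K where K: "\<And>x. x \<in> lev T k \<Longrightarrow> norm (pair T k f x) \<le> K * norm x"
    unfolding bounded_functional_def by blast
  have bdd: "bdd_above ((\<lambda>x. norm (pair T k f x)) ` {x \<in> lev T k. norm x \<le> 1})"
  proof (rule bdd_aboveI2)
    fix x assume x: "x \<in> {x \<in> lev T k. norm x \<le> 1}"
    have "K * norm x \<le> \<bar>K\<bar> * 1" using x by (intro mult_mono) auto
    with K[of x] x show "norm (pair T k f x) \<le> \<bar>K\<bar>" by simp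
  qed
  let ?y = "(1 / norm x) *\<^sub>R x"
  have y: "?y \<in> lev T k" using space_at_subspace(4)[OF dual_at_space(1)[OF d] x] .
  have "norm (pair T k f ?y) \<le> (SUP x\<in>{x \<in> lev T k. norm x \<le> 1}. norm (pair T k f x))"
    by (rule cSUP_upper[OF _ bdd]) (use y False in simp)
  also have "\<dots> = norm f" using isd f by (simp add: is_dual_def)
  finally have "norm (pair T k f x) / norm x \<le> norm f"
    using pair_simps(3)[OF d f x, of "1 / norm x"] by (simp add: norm_mult norm_divide)
  then show ?thesis using False by (simp add: field_simps)
qed

lemma dual_norm_le:
  assumes d: "dual_at T k" and f: "f \<in> lev T (Suc k)"
    and C: "\<And>x. x \<in> lev T k \<Longrightarrow> norm (pair T k f x) \<le> C * norm x" "C \<ge> 0"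
  shows "norm f \<le> C"
proof -
  have "norm f = (SUP x\<in>{x \<in> lev T k. norm x \<le> 1}. norm (pair T k f x))"
    using d f by (simp add: dual_at_def is_dual_def)
  also have "\<dots> \<le> C"
  proof (rule cSUP_least)
    show "{x \<in> lev T k. norm x \<le> 1} \<noteq> {}"
      using space_at_subspace(1)[OF dual_at_space(1)[OF d]] by (auto intro!: exI[of _ 0])
    fix x assume "x \<in> {x \<in> lev T k. norm x \<le> 1}"
    then show "norm (pair T k f x) \<le> C"
      using C(1)[of x] mult_left_mono[of "norm x" 1 C] C(2) by simp
  qed
  finally show ?thesis .
qed

lemma dual_ex:
  assumes "dual_at T k" "bounded_functional (scal T) (lev T k) \<phi>"
  obtains f where "f \<in> lev T (Suc k)" "\<And>x. x \<in> lev T k \<Longrightarrow> pair T k f x = \<phi> x"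
  using assms unfolding dual_at_def is_dual_def by metis

lemma dual_eqI:
  assumes d: "dual_at T k" and f: "f \<in> lev T (Suc k)" and g: "g \<in> lev T (Suc k)"
    and eq: "\<And>x. x \<in> lev T k \<Longrightarrow> pair T k f x = pair T k g x"
  shows "f = g"
proof -
  have "bounded_functional (scal T) (lev T k) (pair T k g)"
    using d g by (simp add: dual_at_def is_dual_def)
  then have "\<exists>!f. f \<in> lev T (Suc k) \<and> (\<forall>x\<in>lev T k. pair T k f x = pair T k g x)"
    using d by (simp add: dual_at_def is_dual_def)
  then show ?thesis using f g eq by blast
qed

lemma complete_dual:
  assumes d: "dual_at T k"
  shows "complete (lev T (Suc k))"
proof (rule completeI)
  fix F :: "nat \<Rightarrow> 'b" assume FX: "\<forall>n. F n \<in> lev T (Suc k)" and F: "Cauchy F"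
  note sp = dual_at_space[OF d]
  note sub = space_at_subspace[OF sp(1)] and sub' = space_at_subspace[OF sp(2)]
  have diff: "norm (pair T k (F m) x - pair T k (F n) x) \<le> norm (F m - F n) * norm x"
    if "x \<in> lev T k" for m n x
    using pair_bound[OF d, of "F m - F n" x] pair_diff(2)[OF d, of "F m" "F n" x] FX that sub' by simp
  have "\<exists>l. (\<lambda>n. pair T k (F n) x) \<longlonglongrightarrow> l" if x: "x \<in> lev T k" for x
  proof -
    have "Cauchy (\<lambda>n. pair T k (F n) x)"
      unfolding Cauchy_iff
    proof (intro allI impI)
      fix e :: real assume "e > 0"
      then have "e / (norm x + 1) > 0" by (simp add: add_nonneg_pos)
      then obtain N where N: "\<And>m n. m \<ge> N \<Longrightarrow> n \<ge> N \<Longrightarrow> norm (F m - F n) < e / (norm x + 1)"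
        using F unfolding Cauchy_iff by metis
      have "norm (pair T k (F m) x - pair T k (F n) x) < e" if "m \<ge> N" "n \<ge> N" for m n
      proof -
        have "norm (F m - F n) * norm x \<le> norm (F m - F n) * (norm x + 1)"
          by (intro mult_left_mono) auto
        also have "\<dots> < e / (norm x + 1) * (norm x + 1)"
          by (rule mult_strict_right_mono[OF N[OF that]]) (simp add: add_nonneg_pos)
        also have "\<dots> = e" by (simp add: add_nonneg_eq_0_iff)
        finally show ?thesis using diff[OF x, of m n] by linarith
      qed
      then show "\<exists>M. \<forall>m\<ge>M. \<forall>n\<ge>M. norm (pair T k (F m) x - pair T k (F n) x) < e" by blast
    qed
    then show ?thesis using complete_scalars unfolding complete_def by auto
  qed
  then obtain \<phi> where \<phi>: "\<And>x. x \<in> lev T k \<Longrightarrow> (\<lambda>n. pair T k (F n) x) \<longlonglongrightarrow> \<phi> x" by metis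
  have close: "norm (pair T k (F m) x - \<phi> x) \<le> e * norm x"
    if N: "\<And>n. n \<ge> N \<Longrightarrow> norm (F m - F n) \<le> e" and x: "x \<in> lev T k" for m N e x
  proof (rule LIMSEQ_le_const2)
    show "(\<lambda>n. norm (pair T k (F m) x - pair T k (F n) x)) \<longlonglongrightarrow> norm (pair T k (F m) x - \<phi> x)"
      by (intro tendsto_intros \<phi>[OF x])
    show "\<exists>N. \<forall>n\<ge>N. norm (pair T k (F m) x - pair T k (F n) x) \<le> e * norm x"
      using diff[OF x, of m] N by (meson mult_right_mono norm_ge_zero order_trans)
  qed
  have bf: "bounded_functional (scal T) (lev T k) \<phi>"
    unfolding bounded_functional_def
  proof (intro conjI ballI allI)
    fix x y assume x: "x \<in> lev T k" and y: "y \<in> lev T k"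
    have "(\<lambda>n. pair T k (F n) (x + y)) \<longlonglongrightarrow> \<phi> x + \<phi> y"
      using tendsto_add[OF \<phi>[OF x] \<phi>[OF y]] FX x y by (simp add: pair_simps(1)[OF d])
    then show "\<phi> (x + y) = \<phi> x + \<phi> y" using \<phi>[OF sub(2)[OF x y]] LIMSEQ_unique by blast
  next
    fix c x assume x: "x \<in> lev T k"
    have "(\<lambda>n. pair T k (F n) (scal T c x)) \<longlonglongrightarrow> c * \<phi> x"
      using tendsto_mult[OF tendsto_const \<phi>[OF x]] FX x by (simp add: pair_simps(2)[OF d])
    then show "\<phi> (scal T c x) = c * \<phi> x" using \<phi>[OF sub(3)[OF x]] LIMSEQ_unique by blast
  next
    obtain N where N: "\<And>n. n \<ge> N \<Longrightarrow> norm (F N - F n) < 1"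
      using F unfolding Cauchy_iff by (metis le_refl zero_less_one)
    show "\<exists>K. \<forall>x\<in>lev T k. norm (\<phi> x) \<le> K * norm x"
    proof (intro exI ballI)
      fix x assume x: "x \<in> lev T k"
      have "norm (\<phi> x) \<le> norm (pair T k (F N) x) + norm (pair T k (F N) x - \<phi> x)"
        using norm_triangle_ineq4[of "pair T k (F N) x" "pair T k (F N) x - \<phi> x"] by simp
      also have "\<dots> \<le> norm (F N) * norm x + 1 * norm x"
        using N by (intro add_mono pair_bound[OF d] close[of N] x FX[rule_format]) (simp add: less_imp_le)
      finally show "norm (\<phi> x) \<le> (norm (F N) + 1) * norm x" by (simp add: algebra_simps)
    qed
  qed
  then obtain f where f: "f \<in> lev T (Suc k)" "\<And>x. x \<in> lev T k \<Longrightarrow> pair T k f x = \<phi> x"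
    using dual_ex[OF d] by blast
  have "F \<longlonglongrightarrow> f"
  proof (rule LIMSEQ_I)
    fix e :: real assume "e > 0"
    then have "e / 2 > 0" by simp
    then obtain N where N: "\<And>m n. m \<ge> N \<Longrightarrow> n \<ge> N \<Longrightarrow> norm (F m - F n) < e / 2"
      using F unfolding Cauchy_iff by metis
    have "norm (F m - f) < e" if m: "m \<ge> N" for m
    proof -
      have "norm (F m - f) \<le> e / 2"
      proof (rule dual_norm_le[OF d])
        show "F m - f \<in> lev T (Suc k)" using FX f sub' by blast
        show "norm (pair T k (F m - f) x) \<le> e / 2 * norm x" if x: "x \<in> lev T k" for x
          using close[of N m "e/2" x] N[OF m] x FX f pair_diff(2)[OF d, of "F m" f x]
          by (simp add: less_imp_le)
      qed (use \<open>e > 0\<close> in simp)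
      with \<open>e > 0\<close> show ?thesis by simp
    qed
    then show "\<exists>N. \<forall>n\<ge>N. norm (F n - f) < e" by blast
  qed
  then show "\<exists>l\<in>lev T (Suc k). F \<longlonglongrightarrow> l" using f by blast
qed

lemma iterated_duals_levels:
  assumes "iterated_duals T h"
  shows "k < h \<Longrightarrow> dual_at T k" "k \<le> h \<Longrightarrow> space_at T k" "k \<le> h \<Longrightarrow> complete (lev T k)"
proof -
  have sp: "space_at T k" if "k \<le> h" for k
    using assms that by (cases k) (auto simp: iterated_duals_def space_at_def is_dual_def)
  show du: "dual_at T k" if "k < h" for k
    using assms that sp[of k] by (auto simp: iterated_duals_def dual_at_def)
  show "k \<le> h \<Longrightarrow> space_at T k" by (rule sp)
  show "complete (lev T k)" if "k \<le> h"
  proof (cases k)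
    case 0 then show ?thesis using assms by (simp add: iterated_duals_def)
  next
    case (Suc j) then show ?thesis using complete_dual[of T j] du[of j] that by simp
  qed
qed

lemma canon:
  assumes d: "dual_at T k" "dual_at T (Suc k)" and x: "x \<in> lev T k"
  shows "canon T k x \<in> lev T (Suc (Suc k))"
    "f \<in> lev T (Suc k) \<Longrightarrow> pair T (Suc k) (canon T k x) f = pair T k f x"
proof -
  have "bounded_functional (scal T) (lev T (Suc k)) (\<lambda>f. pair T k f x)"
    unfolding bounded_functional_def
  proof (intro conjI ballI allI)
    show "\<exists>K. \<forall>f\<in>lev T (Suc k). norm (pair T k f x) \<le> K * norm f"
      using pair_bound[OF d(1) _ x] by (intro exI[of _ "norm x"]) (simp add: mult.commute)
  qed (simp_all add: pair_simps[OF d(1)] x)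
  then have "\<exists>!y. y \<in> lev T (Suc (Suc k)) \<and> (\<forall>f\<in>lev T (Suc k). pair T (Suc k) y f = pair T k f x)"
    using d(2) by (simp add: dual_at_def is_dual_def)
  from theI'[OF this] show "canon T k x \<in> lev T (Suc (Suc k))"
    "f \<in> lev T (Suc k) \<Longrightarrow> pair T (Suc k) (canon T k x) f = pair T k f x"
    by (auto simp: canon_def)
qed

section \<open>Arens extensions\<close>

text \<open>
  The three factors sit at independent levels because the adjoints \<open>m\<^sup>*\<close> and \<open>m\<^sup>*\<^sup>*\<close> of a map at
  level \<open>k\<close> mix the levels \<open>k\<close>, \<open>k + 1\<close> and \<open>k + 2\<close>.
\<close>

definition bilinear_at ::
  "('k::real_or_complex, 'x::real_normed_vector) dual_tower \<Rightarrow> nat \<Rightarrow>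
     ('k, 'y::real_normed_vector) dual_tower \<Rightarrow> nat \<Rightarrow>
     ('k, 'z::real_normed_vector) dual_tower \<Rightarrow> nat \<Rightarrow> ('x \<Rightarrow> 'y \<Rightarrow> 'z) \<Rightarrow> bool" where
  "bilinear_at X i Y j Z l m \<longleftrightarrow>
     (\<forall>x\<in>lev X i. \<forall>y\<in>lev Y j. m x y \<in> lev Z l) \<and>
     (\<forall>x\<in>lev X i. \<forall>x'\<in>lev X i. \<forall>y\<in>lev Y j. m (x + x') y = m x y + m x' y) \<and>
     (\<forall>x\<in>lev X i. \<forall>y\<in>lev Y j. \<forall>y'\<in>lev Y j. m x (y + y') = m x y + m x y') \<and>
     (\<forall>c. \<forall>x\<in>lev X i. \<forall>y\<in>lev Y j.
        m (scal X c x) y = scal Z c (m x y) \<and> m x (scal Y c y) = scal Z c (m x y)) \<and>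
     (\<exists>K\<ge>0. \<forall>x\<in>lev X i. \<forall>y\<in>lev Y j. norm (m x y) \<le> K * norm x * norm y)"

lemma bilinear_at_0:
  assumes "bounded_bilinear_on X Y Z m"
  shows "bilinear_at X 0 Y 0 Z 0 m"
proof -
  obtain K where K: "\<forall>x\<in>lev X 0. \<forall>y\<in>lev Y 0. norm (m x y) \<le> K * norm x * norm y"
    using assms unfolding bounded_bilinear_on_def by blast
  have "norm (m x y) \<le> \<bar>K\<bar> * norm x * norm y" if "x \<in> lev X 0" "y \<in> lev Y 0" for x y
  proof -
    have "K * norm x * norm y \<le> \<bar>K\<bar> * norm x * norm y" by (intro mult_right_mono) auto
    with K that show ?thesis by fastforce
  qed
  then show ?thesis
    using assms unfolding bounded_bilinear_on_def bilinear_at_def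
    by (intro conjI; (elim conjE; assumption)?) (auto intro!: exI[of _ "\<bar>K\<bar>"])
qed

lemma bilinear_at_simps:
  assumes "bilinear_at X i Y j Z l m"
  shows "x \<in> lev X i \<Longrightarrow> y \<in> lev Y j \<Longrightarrow> m x y \<in> lev Z l"
    "x \<in> lev X i \<Longrightarrow> x' \<in> lev X i \<Longrightarrow> y \<in> lev Y j \<Longrightarrow> m (x + x') y = m x y + m x' y"
    "x \<in> lev X i \<Longrightarrow> y \<in> lev Y j \<Longrightarrow> y' \<in> lev Y j \<Longrightarrow> m x (y + y') = m x y + m x y'"
    "x \<in> lev X i \<Longrightarrow> y \<in> lev Y j \<Longrightarrow> m (scal X c x) y = scal Z c (m x y)"
    "x \<in> lev X i \<Longrightarrow> y \<in> lev Y j \<Longrightarrow> m x (scal Y c y) = scal Z c (m x y)"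
  using assms by (simp_all add: bilinear_at_def)

lemma bilinear_at_scaleR:
  assumes "bilinear_at X i Y j Z l m" and s: "space_at X i" "space_at Y j" "space_at Z l"
    and "x \<in> lev X i" "y \<in> lev Y j"
  shows "m (r *\<^sub>R x) y = r *\<^sub>R m x y" "m x (r *\<^sub>R y) = r *\<^sub>R m x y"
  using bilinear_at_simps(4,5)[OF assms(1) assms(5,6), of "of_real r"]
  by (simp_all add: scal_simps(1)[OF s(1)] scal_simps(1)[OF s(2)] scal_simps(1)[OF s(3)])

lemma bilinear_at_bound:
  assumes "bilinear_at X i Y j Z l m"
  obtains K where "K \<ge> 0" "\<And>x y. x \<in> lev X i \<Longrightarrow> y \<in> lev Y j \<Longrightarrow> norm (m x y) \<le> K * norm x * norm y"
proof -
  have "\<exists>K\<ge>0. \<forall>x\<in>lev X i. \<forall>y\<in>lev Y j. norm (m x y) \<le> K * norm x * norm y"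
    using assms by (simp add: bilinear_at_def)
  then show ?thesis using that by blast
qed

lemma bilinear_at_swap:
  assumes m: "bilinear_at X i Y j Z l m"
  shows "bilinear_at Y j X i Z l (\<lambda>y x. m x y)"
proof -
  obtain K where K: "K \<ge> 0" "\<And>x y. x \<in> lev X i \<Longrightarrow> y \<in> lev Y j \<Longrightarrow> norm (m x y) \<le> K * norm x * norm y"
    using bilinear_at_bound[OF m] by blast
  have "norm (m x y) \<le> K * norm y * norm x" if "x \<in> lev X i" "y \<in> lev Y j" for x y
    using K(2)[OF that] by (simp only: mult.assoc mult.commute[of "norm y"])
  with K(1) have "\<exists>K\<ge>0. \<forall>y\<in>lev Y j. \<forall>x\<in>lev X i. norm (m x y) \<le> K * norm y * norm x"
    by blast
  then show ?thesis unfolding bilinear_at_def by (simp add: bilinear_at_simps[OF m])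
qed

lemma bounded_functional_pair:
  assumes Z: "dual_at Z l" and m: "bilinear_at X i Y j Z l m"
    and z: "z' \<in> lev Z (Suc l)" and x: "x \<in> lev X i"
  shows "bounded_functional (scal Y) (lev Y j) (\<lambda>y. pair Z l z' (m x y))"
proof -
  obtain K where K: "K \<ge> 0" "\<And>x y. x \<in> lev X i \<Longrightarrow> y \<in> lev Y j \<Longrightarrow> norm (m x y) \<le> K * norm x * norm y"
    using bilinear_at_bound[OF m] by blast
  have "norm (pair Z l z' (m x y)) \<le> norm z' * (K * norm x) * norm y" if y: "y \<in> lev Y j" for y
  proof -
    have "norm (pair Z l z' (m x y)) \<le> norm z' * norm (m x y)"
      by (rule pair_bound[OF Z z bilinear_at_simps(1)[OF m x y]])
    also have "\<dots> \<le> norm z' * (K * norm x * norm y)" by (intro mult_left_mono K x y) simp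
    finally show ?thesis by (simp add: mult.assoc)
  qed
  then have "\<exists>C. \<forall>y\<in>lev Y j. norm (pair Z l z' (m x y)) \<le> C * norm y" by blast
  then show ?thesis unfolding bounded_functional_def
    using z x by (simp add: bilinear_at_simps[OF m] pair_simps[OF Z])
qed

lemma adjoint:
  assumes Y: "dual_at Y j" and Z: "dual_at Z l" and m: "bilinear_at X i Y j Z l m"
    and z: "z' \<in> lev Z (Suc l)" and x: "x \<in> lev X i"
  shows "adjoint Y j Z l m z' x \<in> lev Y (Suc j)"
    "y \<in> lev Y j \<Longrightarrow> pair Y j (adjoint Y j Z l m z' x) y = pair Z l z' (m x y)"
proof -
  have "\<exists>!f. f \<in> lev Y (Suc j) \<and> (\<forall>y\<in>lev Y j. pair Y j f y = pair Z l z' (m x y))"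
    using Y bounded_functional_pair[OF Z m z x] by (simp add: dual_at_def is_dual_def)
  from theI'[OF this] show "adjoint Y j Z l m z' x \<in> lev Y (Suc j)"
    "y \<in> lev Y j \<Longrightarrow> pair Y j (adjoint Y j Z l m z' x) y = pair Z l z' (m x y)"
    by (simp_all add: adjoint_def)
qed

lemma bilinear_at_adjoint:
  assumes X: "space_at X i" and Y: "dual_at Y j" and Z: "dual_at Z l" and m: "bilinear_at X i Y j Z l m"
  shows "bilinear_at Z (Suc l) X i Y (Suc j) (adjoint Y j Z l m)"
proof -
  note adj = adjoint[OF Y Z m]
  note subX = space_at_subspace[OF X] and subZ = space_at_subspace[OF dual_at_space(2)[OF Z]]
    and subY = space_at_subspace[OF dual_at_space(2)[OF Y]]
  note simps = adj subX subZ subY bilinear_at_simps[OF m] pair_simps[OF Y] pair_simps[OF Z]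
  obtain K where K: "K \<ge> 0" "\<And>x y. x \<in> lev X i \<Longrightarrow> y \<in> lev Y j \<Longrightarrow> norm (m x y) \<le> K * norm x * norm y"
    using bilinear_at_bound[OF m] by blast
  show ?thesis
    unfolding bilinear_at_def
  proof (intro conjI ballI allI)
    show "\<exists>K\<ge>0. \<forall>z'\<in>lev Z (Suc l). \<forall>x\<in>lev X i. norm (adjoint Y j Z l m z' x) \<le> K * norm z' * norm x"
    proof (intro exI[of _ K] conjI ballI K(1))
      fix z' x assume z: "z' \<in> lev Z (Suc l)" and x: "x \<in> lev X i"
      show "norm (adjoint Y j Z l m z' x) \<le> K * norm z' * norm x"
      proof (rule dual_norm_le[OF Y adj(1)[OF z x]])
        fix y assume y: "y \<in> lev Y j"
        have "norm (pair Z l z' (m x y)) \<le> norm z' * norm (m x y)"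
          by (rule pair_bound[OF Z z bilinear_at_simps(1)[OF m x y]])
        also have "\<dots> \<le> norm z' * (K * norm x * norm y)" by (intro mult_left_mono K x y) simp
        finally show "norm (pair Y j (adjoint Y j Z l m z' x) y) \<le> K * norm z' * norm x * norm y"
          by (simp add: adj(2)[OF z x y] mult_ac)
      qed (use K in simp)
    qed
  qed (rule dual_eqI[OF Y] adj; simp add: simps)+
qed

text \<open>
  The intermediate maps \<open>m\<^sup>*\<close> and \<open>m\<^sup>*\<^sup>*\<close> on the way to the Arens extension \<open>m\<^sup>*\<^sup>*\<^sup>*\<close>.
\<close>

abbreviation "adj1 Y k Z m \<equiv> adjoint Y k Z k m"
abbreviation "adj2 X Y Z k m \<equiv> adjoint X k Y (Suc k) (adj1 Y k Z m)"

lemma arens_unfold: "arens X Y Z k m = adjoint Z (Suc k) X (Suc k) (adj2 X Y Z k m)"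
  by (simp add: arens_def)

context
  fixes X :: "('k::real_or_complex, 'x::real_normed_vector) dual_tower"
    and Y :: "('k, 'y::real_normed_vector) dual_tower"
    and Z :: "('k, 'z::real_normed_vector) dual_tower"
    and k m
  assumes X: "dual_at X k" "dual_at X (Suc k)" and Y: "dual_at Y k" "dual_at Y (Suc k)"
    and Z: "dual_at Z k" "dual_at Z (Suc k)" and m: "bilinear_at X k Y k Z k m"
begin

lemma bilinear_adj1: "bilinear_at Z (Suc k) X k Y (Suc k) (adj1 Y k Z m)"
  by (rule bilinear_at_adjoint[OF dual_at_space(1)[OF X(1)] Y(1) Z(1) m])

lemma bilinear_adj2: "bilinear_at Y (Suc (Suc k)) Z (Suc k) X (Suc k) (adj2 X Y Z k m)"
  by (rule bilinear_at_adjoint[OF dual_at_space(1)[OF Z(2)] X(1) Y(2) bilinear_adj1])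

lemma bilinear_arens: "bilinear_at X (Suc (Suc k)) Y (Suc (Suc k)) Z (Suc (Suc k)) (arens X Y Z k m)"
  unfolding arens_unfold
  by (rule bilinear_at_adjoint[OF dual_at_space(2)[OF Y(2)] Z(2) X(2) bilinear_adj2])

lemma adj1_in: "z' \<in> lev Z (Suc k) \<Longrightarrow> x \<in> lev X k \<Longrightarrow> adj1 Y k Z m z' x \<in> lev Y (Suc k)"
  and pair_adj1: "z' \<in> lev Z (Suc k) \<Longrightarrow> x \<in> lev X k \<Longrightarrow> y \<in> lev Y k \<Longrightarrow>
    pair Y k (adj1 Y k Z m z' x) y = pair Z k z' (m x y)"
  using adjoint[OF Y(1) Z(1) m] by auto

lemma adj2_in: "y'' \<in> lev Y (Suc (Suc k)) \<Longrightarrow> z' \<in> lev Z (Suc k) \<Longrightarrow> adj2 X Y Z k m y'' z' \<in> lev X (Suc k)"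
  and pair_adj2: "y'' \<in> lev Y (Suc (Suc k)) \<Longrightarrow> z' \<in> lev Z (Suc k) \<Longrightarrow> x \<in> lev X k \<Longrightarrow>
    pair X k (adj2 X Y Z k m y'' z') x = pair Y (Suc k) y'' (adj1 Y k Z m z' x)"
  using adjoint[OF X(1) Y(2) bilinear_adj1] by auto

lemma arens_in: "x'' \<in> lev X (Suc (Suc k)) \<Longrightarrow> y'' \<in> lev Y (Suc (Suc k)) \<Longrightarrow>
    arens X Y Z k m x'' y'' \<in> lev Z (Suc (Suc k))"
  and pair_arens: "x'' \<in> lev X (Suc (Suc k)) \<Longrightarrow> y'' \<in> lev Y (Suc (Suc k)) \<Longrightarrow> z' \<in> lev Z (Suc k) \<Longrightarrow>
    pair Z (Suc k) (arens X Y Z k m x'' y'') z' = pair X (Suc k) x'' (adj2 X Y Z k m y'' z')"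
  unfolding arens_unfold using adjoint[OF Z(2) X(2) bilinear_adj2] by auto

lemma arens_canon_left:
  assumes x: "x \<in> lev X k" and y: "y'' \<in> lev Y (Suc (Suc k))" and z: "z' \<in> lev Z (Suc k)"
  shows "pair Z (Suc k) (arens X Y Z k m (canon X k x) y'') z' = pair Y (Suc k) y'' (adj1 Y k Z m z' x)"
  using x y z by (simp add: pair_arens canon[OF X] adj2_in pair_adj2)

lemma adj2_canon:
  assumes y: "y \<in> lev Y k" and z: "z' \<in> lev Z (Suc k)" and x: "x \<in> lev X k"
  shows "pair X k (adj2 X Y Z k m (canon Y k y) z') x = pair Z k z' (m x y)"
  using x y z by (simp add: canon[OF Y] pair_adj2 adj1_in pair_adj1)

end

text \<open>
  For products and module actions on a bidual this is the associativity that factorization needs.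
  The law for four maps covers all cases at once. Unfolding the pairings moves the claim from the
  second duals down through \<open>m\<^sup>*\<^sup>*\<close> and \<open>m\<^sup>*\<close> to the law on elements of level \<open>k\<close>.
\<close>

lemma arens_assoc:
  assumes X: "dual_at X k" "dual_at X (Suc k)" and Y: "dual_at Y k" "dual_at Y (Suc k)"
    and Z: "dual_at Z k" "dual_at Z (Suc k)" and V: "dual_at V k" "dual_at V (Suc k)"
    and U: "dual_at U k" "dual_at U (Suc k)" and W: "dual_at W k" "dual_at W (Suc k)"
    and m1: "bilinear_at V k Z k W k m1" and m2: "bilinear_at X k Y k V k m2"
    and m3: "bilinear_at X k U k W k m3" and m4: "bilinear_at Y k Z k U k m4"
    and assoc: "\<And>x y z. x \<in> lev X k \<Longrightarrow> y \<in> lev Y k \<Longrightarrow> z \<in> lev Z k \<Longrightarrow> m1 (m2 x y) z = m3 x (m4 y z)"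
    and x: "x'' \<in> lev X (Suc (Suc k))" and y: "y'' \<in> lev Y (Suc (Suc k))" and z: "z'' \<in> lev Z (Suc (Suc k))"
  shows "arens V Z W k m1 (arens X Y V k m2 x'' y'') z'' = arens X U W k m3 x'' (arens Y Z U k m4 y'' z'')"
proof (rule dual_eqI[OF W(2)])
  note in1 = arens_in[OF V Z W m1] adj2_in[OF V Z W m1] adj1_in[OF V Z W m1]
  note in2 = arens_in[OF X Y V m2] adj2_in[OF X Y V m2] adj1_in[OF X Y V m2]
  note in3 = arens_in[OF X U W m3] adj2_in[OF X U W m3] adj1_in[OF X U W m3]
  note in4 = arens_in[OF Y Z U m4] adj2_in[OF Y Z U m4] adj1_in[OF Y Z U m4]
  note ins = in1 in2 in3 in4
  show "arens V Z W k m1 (arens X Y V k m2 x'' y'') z'' \<in> lev W (Suc (Suc k))"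
    "arens X U W k m3 x'' (arens Y Z U k m4 y'' z'') \<in> lev W (Suc (Suc k))"
    using x y z by (simp_all add: ins)
  fix w' assume w: "w' \<in> lev W (Suc k)"
  have 1: "adj1 Z k W m1 w' (m2 x y) = adj1 Z k U m4 (adj1 U k W m3 w' x) y"
    if "x \<in> lev X k" "y \<in> lev Y k" for x y
    by (rule dual_eqI[OF Z(1)])
      (use that w in \<open>simp_all add: ins bilinear_at_simps(1)[OF m2] bilinear_at_simps(1)[OF m4]
        pair_adj1[OF V Z W m1] pair_adj1[OF X U W m3] pair_adj1[OF Y Z U m4] assoc\<close>)
  have 2: "adj1 Y k V m2 (adj2 V Z W k m1 z'' w') x = adj2 Y Z U k m4 z'' (adj1 U k W m3 w' x)"
    if "x \<in> lev X k" for x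
    by (rule dual_eqI[OF Y(1)])
      (use that w z in \<open>simp_all add: ins bilinear_at_simps(1)[OF m2]
        pair_adj1[OF X Y V m2] pair_adj2[OF V Z W m1] pair_adj2[OF Y Z U m4] 1\<close>)
  have 3: "adj2 X Y V k m2 y'' (adj2 V Z W k m1 z'' w') = adj2 X U W k m3 (arens Y Z U k m4 y'' z'') w'"
    by (rule dual_eqI[OF X(1)])
      (use w z y in \<open>simp_all add: ins pair_adj2[OF X Y V m2] pair_adj2[OF X U W m3]
        pair_arens[OF Y Z U m4] 2\<close>)
  show "pair W (Suc k) (arens V Z W k m1 (arens X Y V k m2 x'' y'') z'') w' =
      pair W (Suc k) (arens X U W k m3 x'' (arens Y Z U k m4 y'' z'')) w'"
    using w z y x by (simp add: ins pair_arens[OF V Z W m1] pair_arens[OF X Y V m2]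
        pair_arens[OF X U W m3] 3)
qed

lemma bilinear_arens_iter:
  assumes "iterated_duals X h" "iterated_duals Y h" "iterated_duals Z h"
    and "bounded_bilinear_on X Y Z m" and "even k" "k \<le> h"
  shows "bilinear_at X k Y k Z k (arens_iter X Y Z m k)"
  using \<open>even k\<close> \<open>k \<le> h\<close>
proof (induction k rule: induct_nat_012)
  case (ge2 k)
  then show ?case
    using bilinear_arens[of X k Y Z] iterated_duals_levels(1)[OF assms(1)]
      iterated_duals_levels(1)[OF assms(2)] iterated_duals_levels(1)[OF assms(3)] by simp
qed (use bilinear_at_0[OF assms(4)] in auto)

lemma arens_iter_assoc:
  assumes X: "iterated_duals X h" and Y: "iterated_duals Y h" and Z: "iterated_duals Z h"
    and V: "iterated_duals V h" and U: "iterated_duals U h" and W: "iterated_duals W h"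
    and m1: "bounded_bilinear_on V Z W m1" and m2: "bounded_bilinear_on X Y V m2"
    and m3: "bounded_bilinear_on X U W m3" and m4: "bounded_bilinear_on Y Z U m4"
    and assoc: "\<And>x y z. x \<in> lev X 0 \<Longrightarrow> y \<in> lev Y 0 \<Longrightarrow> z \<in> lev Z 0 \<Longrightarrow> m1 (m2 x y) z = m3 x (m4 y z)"
    and "even k" "k \<le> h" "x \<in> lev X k" "y \<in> lev Y k" "z \<in> lev Z k"
  shows "arens_iter V Z W m1 k (arens_iter X Y V m2 k x y) z =
    arens_iter X U W m3 k x (arens_iter Y Z U m4 k y z)"
  using assms(12-)
proof (induction k arbitrary: x y z rule: induct_nat_012)
  case (ge2 k)
  have k: "even k" "k \<le> h" "k < h" "Suc k < h" using ge2.prems by auto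
  note d = iterated_duals_levels(1)[OF X k(3)] iterated_duals_levels(1)[OF X k(4)]
    iterated_duals_levels(1)[OF Y k(3)] iterated_duals_levels(1)[OF Y k(4)]
    iterated_duals_levels(1)[OF Z k(3)] iterated_duals_levels(1)[OF Z k(4)]
    iterated_duals_levels(1)[OF V k(3)] iterated_duals_levels(1)[OF V k(4)]
    iterated_duals_levels(1)[OF U k(3)] iterated_duals_levels(1)[OF U k(4)]
    iterated_duals_levels(1)[OF W k(3)] iterated_duals_levels(1)[OF W k(4)]
  show ?case
    unfolding arens_iter.simps
    by (rule arens_assoc[OF d bilinear_arens_iter[OF V Z W m1 k(1,2)] bilinear_arens_iter[OF X Y V m2 k(1,2)]
        bilinear_arens_iter[OF X U W m3 k(1,2)] bilinear_arens_iter[OF Y Z U m4 k(1,2)]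
        ge2.IH(1)[OF k(1,2)] ge2.prems(3-5)])
qed (use assoc in auto)

section \<open>Weak topologies\<close>

lemma pullback_product_nbhd:
  assumes U: "openin (pullback_topology S (\<lambda>x. \<lambda>i\<in>I. p x i) (product_topology (\<lambda>_. euclidean) I)) U"
    and x: "x \<in> U"
  obtains F N where "finite F" "F \<subseteq> I" "\<And>i. i \<in> F \<Longrightarrow> open (N i) \<and> p x i \<in> N i"
    "\<And>y. y \<in> S \<Longrightarrow> (\<And>i. i \<in> F \<Longrightarrow> p y i \<in> N i) \<Longrightarrow> y \<in> U"
proof -
  obtain V where V: "openin (product_topology (\<lambda>_. euclidean) I) V"
    and UV: "U = (\<lambda>x. \<lambda>i\<in>I. p x i) -` V \<inter> S"
    using U by (auto simp: openin_pullback_topology)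
  have xV: "(\<lambda>i\<in>I. p x i) \<in> V" using x UV by simp
  obtain W where W: "(\<lambda>i\<in>I. p x i) \<in> Pi\<^sub>E I W" "\<And>i. openin euclidean (W i)"
    "finite {i. W i \<noteq> topspace euclidean}" "Pi\<^sub>E I W \<subseteq> V"
    using product_topology_open_contains_basis[OF V xV] by blast
  show ?thesis
  proof (rule that[of "{i \<in> I. W i \<noteq> UNIV}" W])
    show "finite {i \<in> I. W i \<noteq> UNIV}" using W(3) by simp
    show "open (W i) \<and> p x i \<in> W i" if "i \<in> {i \<in> I. W i \<noteq> UNIV}" for i
      using W(1,2) that by (auto simp: PiE_iff)
    show "y \<in> U" if "y \<in> S" and y: "\<And>i. i \<in> {i \<in> I. W i \<noteq> UNIV} \<Longrightarrow> p y i \<in> W i" for y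
    proof -
      have "(\<lambda>i\<in>I. p y i) \<in> Pi\<^sub>E I W" using y by (fastforce simp: PiE_iff)
      from subsetD[OF W(4) this] show ?thesis using UV \<open>y \<in> S\<close> by simp
    qed
  qed auto
qed

lemma openin_pullback_product:
  assumes "i \<in> I" "open V"
  shows "openin (pullback_topology S (\<lambda>x. \<lambda>i\<in>I. p x i) (product_topology (\<lambda>_. euclidean) I)) {x \<in> S. p x i \<in> V}"
proof -
  have "openin (product_topology (\<lambda>_. euclidean) I) {f \<in> topspace (product_topology (\<lambda>_. euclidean) I). f i \<in> V}"
    by (rule openin_continuous_map_preimage[OF continuous_map_product_projection[OF assms(1)]])
      (use assms in simp)
  moreover have "{x \<in> S. p x i \<in> V} =
      (\<lambda>x. \<lambda>i\<in>I. p x i) -` {f \<in> topspace (product_topology (\<lambda>_. euclidean) I). f i \<in> V} \<inter> S"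
    using assms(1) by auto
  ultimately show ?thesis unfolding openin_pullback_topology by blast
qed

lemma topspace_weak_star: "topspace (weak_star T k) = lev T k"
  by (auto simp: weak_star_def topspace_pullback_topology)

lemma openin_weak_star:
  "y \<in> lev T k \<Longrightarrow> open V \<Longrightarrow> openin (weak_star T (Suc k)) {x \<in> lev T (Suc k). pair T k x y \<in> V}"
  unfolding weak_star_def using openin_pullback_product[of y "lev T k" V] by simp

lemma openin_weak:
  "f \<in> lev T (Suc k) \<Longrightarrow> open V \<Longrightarrow> openin (weak T k) {x \<in> lev T k. pair T k f x \<in> V}"
  unfolding weak_def using openin_pullback_product[of f "lev T (Suc k)" V "lev T k" "\<lambda>x f. pair T k f x"] by simp

lemma weak_star_nbhd:
  assumes "openin (weak_star T (Suc k)) U" "x \<in> U"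
  obtains F N where "finite F" "F \<subseteq> lev T k" "\<And>i. i \<in> F \<Longrightarrow> open (N i) \<and> pair T k x i \<in> N i"
    "\<And>y. y \<in> lev T (Suc k) \<Longrightarrow> (\<And>i. i \<in> F \<Longrightarrow> pair T k y i \<in> N i) \<Longrightarrow> y \<in> U"
  using pullback_product_nbhd[OF assms[unfolded weak_star_def diff_Suc_1]] by blast

text \<open>
  Applying the hypothesis to the neighbourhood filter turns the formulation with nets into the one
  with open sets.
\<close>

lemma point_continuous_nbhd:
  assumes "point_continuous S T f x" "x \<in> topspace S" "openin T V" "f x \<in> V"
  obtains U where "openin S U" "x \<in> U" "\<And>y. y \<in> U \<Longrightarrow> f y \<in> V"
proof -
  have "limitin S (\<lambda>y. y) x (nhdsin S x)"
    unfolding limitin_def using assms(2) by (auto simp: eventually_nhdsin)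
  then have "limitin T f (f x) (nhdsin S x)"
    using assms(1) by (simp add: point_continuous_def)
  then have "eventually (\<lambda>y. f y \<in> V) (nhdsin S x)"
    using assms(3,4) by (simp add: limitin_def)
  then show ?thesis using that assms(2) by (auto simp: eventually_nhdsin)
qed

section \<open>Density of a space in its bidual\<close>

text \<open>
  Linear algebra alone: a functional that vanishes on the common kernel of finitely many
  functionals is a combination of them. The induction hypothesis is used for the new functional \<open>f\<close>,
  for \<open>g\<close>, and for the correction of \<open>g\<close> by a multiple of \<open>f\<close>.
\<close>

lemma functional_span_or_separate:
  fixes T :: "('k::real_or_complex, 'u::real_normed_vector) dual_tower"
  assumes d: "dual_at T k" and "finite F" "F \<subseteq> lev T (Suc k)" "g \<in> lev T (Suc k)"
  shows "(\<exists>v\<in>lev T k. (\<forall>f\<in>F. pair T k f v = 0) \<and> pair T k g v = 1) \<or>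
    (\<exists>c. g = (\<Sum>f\<in>F. scal T (c f) f))"
  using assms(2-4)
proof (induction F arbitrary: g rule: finite_induct)
  case empty
  note s0 = space_at_subspace[OF dual_at_space(1)[OF d]]
  note s1 = space_at_subspace[OF dual_at_space(2)[OF d]]
  show ?case
  proof (cases "\<exists>v\<in>lev T k. pair T k g v \<noteq> 0")
    case True
    then obtain v where v: "v \<in> lev T k" "pair T k g v \<noteq> 0" by blast
    then have "pair T k g (scal T (1 / pair T k g v) v) = 1" "scal T (1 / pair T k g v) v \<in> lev T k"
      using empty by (simp_all add: pair_simps[OF d] s0)
    then show ?thesis by blast
  next
    case False
    have "g = 0"
      by (rule dual_eqI[OF d]) (use empty False pair_simps(6)[OF d, of 0 _ 0] s1 in auto)
    then show ?thesis by simp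
  qed
next
  case (insert f F)
  note s0 = space_at_subspace[OF dual_at_space(1)[OF d]]
  note s1 = space_at_subspace[OF dual_at_space(2)[OF d]]
  have fin: "f \<in> lev T (Suc k)" "F \<subseteq> lev T (Suc k)" "g \<in> lev T (Suc k)" using insert.prems by auto
  have FD: "f' \<in> lev T (Suc k)" if "f' \<in> F" for f' using fin that by auto
  have "normed_scaling (scal T)" using dual_at_space(1)[OF d] by (simp add: space_at_def)
  then interpret vector_space "scal T" by (rule normed_scaling_vector_space)
  from insert.IH[OF fin(2,1)] show ?case
  proof
    assume "\<exists>w\<in>lev T k. (\<forall>h\<in>F. pair T k h w = 0) \<and> pair T k f w = 1"
    then obtain w where w: "w \<in> lev T k" "\<And>h. h \<in> F \<Longrightarrow> pair T k h w = 0" "pair T k f w = 1" by blast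
    let ?t = "pair T k g w"
    have g': "g - scal T ?t f \<in> lev T (Suc k)" using fin s1 by simp
    from insert.IH[OF fin(2) g'] show ?thesis
    proof
      assume "\<exists>v\<in>lev T k. (\<forall>h\<in>F. pair T k h v = 0) \<and> pair T k (g - scal T ?t f) v = 1"
      then obtain v where v: "v \<in> lev T k" "\<And>h. h \<in> F \<Longrightarrow> pair T k h v = 0"
        "pair T k (g - scal T ?t f) v = 1" by blast
      let ?u = "v - scal T (pair T k f v) w"
      have "?u \<in> lev T k" "pair T k f ?u = 0" "pair T k g ?u = 1"
        using v w fin s0 s1 by (simp_all add: pair_simps[OF d] pair_diff[OF d] mult.commute)
      moreover have "pair T k h ?u = 0" if "h \<in> F" for h
        using v w fin s0 FD[OF that] that by (simp add: pair_simps[OF d] pair_diff[OF d])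
      ultimately show ?thesis by blast
    next
      assume "\<exists>c. g - scal T ?t f = (\<Sum>f\<in>F. scal T (c f) f)"
      then obtain c where c: "g - scal T ?t f = (\<Sum>f\<in>F. scal T (c f) f)" by blast
      have "(\<Sum>h\<in>insert f F. scal T ((c(f := ?t)) h) h) = scal T ?t f + (\<Sum>h\<in>F. scal T (c h) h)"
        using insert.hyps by (auto intro!: sum.cong)
      also have "\<dots> = g" using c by (simp add: algebra_simps)
      finally show ?thesis by metis
    qed
  next
    assume "\<exists>c. f = (\<Sum>f\<in>F. scal T (c f) f)"
    then obtain c where c: "f = (\<Sum>h\<in>F. scal T (c h) h)" by blast
    from insert.IH[OF fin(2,3)] show ?thesis
    proof
      assume "\<exists>v\<in>lev T k. (\<forall>h\<in>F. pair T k h v = 0) \<and> pair T k g v = 1"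
      then obtain v where v: "v \<in> lev T k" "\<And>h. h \<in> F \<Longrightarrow> pair T k h v = 0" "pair T k g v = 1" by blast
      have "G \<subseteq> F \<Longrightarrow> (\<Sum>h\<in>G. scal T (c h) h) \<in> lev T (Suc k) \<and> pair T k (\<Sum>h\<in>G. scal T (c h) h) v = 0"
        if "finite G" for G
        using that
      proof (induction G rule: finite_induct)
        case empty
        then show ?case using pair_simps(6)[OF d, of 0 v 0] s1 v by simp
      next
        case (insert h G)
        then show ?case using v FD s1 by (simp add: pair_simps[OF d])
      qed
      from this[OF insert.hyps(1)] c have "pair T k f v = 0" by simp
      with v show ?thesis by auto
    next
      assume "\<exists>c. g = (\<Sum>f\<in>F. scal T (c f) f)"
      then obtain b where b: "g = (\<Sum>h\<in>F. scal T (b h) h)" by blast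
      have "(\<Sum>h\<in>insert f F. scal T ((b(f := 0)) h) h) = (\<Sum>h\<in>F. scal T (b h) h)"
        using insert.hyps by (auto intro!: sum.cong)
      with b show ?thesis by metis
    qed
  qed
qed

text \<open>
  An element of the bidual respects all linear relations between the functionals in \<open>F\<close>, so the
  values it assigns to them are also attained at a point of the space. No control of the norm of
  that point is claimed; bounds enter only through a separation argument later.
\<close>

lemma bidual_finite_agree:
  assumes d: "dual_at T k" "dual_at T (Suc k)" and e: "e \<in> lev T (Suc (Suc k))"
    and "finite F" "F \<subseteq> lev T (Suc k)"
  shows "\<exists>x\<in>lev T k. \<forall>f\<in>F. pair T k f x = pair T (Suc k) e f"
  using assms(4,5)
proof (induction F rule: finite_induct)
  case empty
  then show ?case using space_at_subspace(1)[OF dual_at_space(1)[OF d(1)]] by auto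
next
  case (insert g F)
  note s0 = space_at_subspace[OF dual_at_space(1)[OF d(1)]]
  note s1 = space_at_subspace[OF dual_at_space(2)[OF d(1)]]
  have gF: "g \<in> lev T (Suc k)" "F \<subseteq> lev T (Suc k)" using insert.prems by auto
  then obtain x where x: "x \<in> lev T k" "\<And>f. f \<in> F \<Longrightarrow> pair T k f x = pair T (Suc k) e f"
    using insert.IH by blast
  have FD: "f' \<in> lev T (Suc k)" if "f' \<in> F" for f' using gF that by auto
  from functional_span_or_separate[OF d(1) insert.hyps(1) gF(2,1)] show ?case
  proof
    assume "\<exists>v\<in>lev T k. (\<forall>f\<in>F. pair T k f v = 0) \<and> pair T k g v = 1"
    then obtain v where v: "v \<in> lev T k" "\<And>f. f \<in> F \<Longrightarrow> pair T k f v = 0" "pair T k g v = 1" by blast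
    let ?u = "x + scal T (pair T (Suc k) e g - pair T k g x) v"
    have "pair T k f ?u = pair T (Suc k) e f" if "f \<in> F" for f
      using x v s0 FD[OF that] that by (simp add: pair_simps[OF d(1)])
    moreover have "?u \<in> lev T k" "pair T k g ?u = pair T (Suc k) e g"
      using x v s0 gF by (simp_all add: pair_simps[OF d(1)])
    ultimately show ?thesis by blast
  next
    assume "\<exists>c. g = (\<Sum>f\<in>F. scal T (c f) f)"
    then obtain c where c: "g = (\<Sum>f\<in>F. scal T (c f) f)" by blast
    have "G \<subseteq> F \<Longrightarrow> (\<Sum>h\<in>G. scal T (c h) h) \<in> lev T (Suc k) \<and>
        pair T k (\<Sum>h\<in>G. scal T (c h) h) x = pair T (Suc k) e (\<Sum>h\<in>G. scal T (c h) h)"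
      if "finite G" for G
      using that
    proof (induction G rule: finite_induct)
      case empty
      then show ?case using pair_simps(6)[OF d(1), of 0 x 0] pair_simps(3)[OF d(2), of e 0 0] s1 x e by simp
    next
      case (insert h G)
      then show ?case using x e FD s1 by (simp add: pair_simps[OF d(1)] pair_simps[OF d(2)])
    qed
    from this[OF insert.hyps(1)] c have "pair T k g x = pair T (Suc k) e g" by simp
    with x show ?thesis by auto
  qed
qed

text \<open>
  Besides weak* density this prescribes the value at one functional \<open>g\<close> exactly, which turns limits
  along nets into plain equations.
\<close>

lemma canon_dense:
  assumes d: "dual_at T k" "dual_at T (Suc k)" and e: "e \<in> lev T (Suc (Suc k))"
    and U: "openin (weak_star T (Suc (Suc k))) U" "e \<in> U" and g: "g \<in> lev T (Suc k)"
  obtains x where "x \<in> lev T k" "canon T k x \<in> U" "pair T k g x = pair T (Suc k) e g"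
proof -
  obtain F N where F: "finite F" "F \<subseteq> lev T (Suc k)"
    and N: "\<And>i. i \<in> F \<Longrightarrow> open (N i) \<and> pair T (Suc k) e i \<in> N i"
    and sub: "\<And>y. y \<in> lev T (Suc (Suc k)) \<Longrightarrow> (\<And>i. i \<in> F \<Longrightarrow> pair T (Suc k) y i \<in> N i) \<Longrightarrow> y \<in> U"
    using weak_star_nbhd[OF U] by blast
  obtain x where x: "x \<in> lev T k" "\<And>f. f \<in> insert g F \<Longrightarrow> pair T k f x = pair T (Suc k) e f"
    using bidual_finite_agree[OF d e, of "insert g F"] F g by blast
  have "canon T k x \<in> U"
  proof (rule sub)
    show "canon T k x \<in> lev T (Suc (Suc k))" by (rule canon[OF d x(1)])
    fix i assume i: "i \<in> F"
    then have "pair T (Suc k) (canon T k x) i = pair T (Suc k) e i"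
      using x(2)[of i] canon(2)[OF d x(1), of i] F(2) by auto
    then show "pair T (Suc k) (canon T k x) i \<in> N i" using N[OF i] by simp
  qed
  with x that show ?thesis by simp
qed

section \<open>Approximate units from a unit of the bidual\<close>

text \<open>
  The seminorm \<open>q v = inf\<^sub>x (norm x / M + norm (v - L x) / \<epsilon>)\<close> is at most \<open>norm x / M\<close> at \<open>L x\<close> and at
  most \<open>norm v / \<epsilon>\<close> at \<open>v\<close>, while \<open>q w \<ge> 1\<close> because either \<open>norm x > M\<close> or \<open>L x\<close> is far from \<open>w\<close>.
  A linear functional below \<open>q\<close> that agrees with \<open>q\<close> at \<open>w\<close> separates.
\<close>

lemma separate_from_image_of_ball:
  fixes L :: "'a::real_normed_vector \<Rightarrow> 'w::real_normed_vector"
  assumes X: "subspace X" and L_add: "\<And>x y. x \<in> X \<Longrightarrow> y \<in> X \<Longrightarrow> L (x + y) = L x + L y"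
    and L_scale: "\<And>r x. x \<in> X \<Longrightarrow> L (r *\<^sub>R x) = r *\<^sub>R L x"
    and M: "M > 0" and \<epsilon>: "\<epsilon> > 0"
    and far: "\<And>x. x \<in> X \<Longrightarrow> norm x \<le> M \<Longrightarrow> norm (w - L x) \<ge> \<epsilon>"
  obtains f where "linear f" "f w \<ge> 1" "\<And>x. x \<in> X \<Longrightarrow> \<bar>f (L x)\<bar> \<le> norm x / M"
    "\<And>v. \<bar>f v\<bar> \<le> norm v / \<epsilon>"
proof -
  define h where "h v x = norm x / M + norm (v - L x) / \<epsilon>" for v x
  define q where "q v = (INF x\<in>X. h v x)" for v
  have X0: "0 \<in> X" "X \<noteq> {}" using subspace_0[OF X] by auto
  have L0: "L 0 = 0" using L_scale[OF X0(1), of 0] by simp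
  have h0: "h v x \<ge> 0" for v x using M \<epsilon> by (simp add: h_def)
  have bdd: "bdd_below (h v ` X)" for v by (rule bdd_belowI2[where m = 0]) (rule h0)
  have le: "q v \<le> h v x" if "x \<in> X" for v x unfolding q_def by (rule cINF_lower[OF bdd that])
  have less: "\<exists>x\<in>X. h v x < c" if "q v < c" for v c
    using that cINF_less_iff[OF X0(2) bdd, of v c] unfolding q_def by auto
  have "sublinear q"
  proof (rule sublinearI)
    fix u v
    show "q (u + v) \<le> q u + q v"
    proof (rule field_le_epsilon)
      fix d :: real assume "d > 0"
      then obtain x y where x: "x \<in> X" "h u x < q u + d / 2" and y: "y \<in> X" "h v y < q v + d / 2"
        using less[of u "q u + d / 2"] less[of v "q v + d / 2"] by auto
      have "q (u + v) \<le> h (u + v) (x + y)" by (rule le[OF subspace_add[OF X x(1) y(1)]])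
      also have "\<dots> \<le> h u x + h v y"
      proof -
        have "norm (x + y) / M \<le> (norm x + norm y) / M"
          using M norm_triangle_ineq[of x y] by (intro divide_right_mono) auto
        moreover have "(u + v) - L (x + y) = (u - L x) + (v - L y)" by (simp add: L_add[OF x(1) y(1)])
        then have "norm ((u + v) - L (x + y)) \<le> norm (u - L x) + norm (v - L y)"
          by (simp only: norm_triangle_ineq)
        then have "norm ((u + v) - L (x + y)) / \<epsilon> \<le> (norm (u - L x) + norm (v - L y)) / \<epsilon>"
          using \<epsilon> by (intro divide_right_mono) auto
        ultimately show ?thesis by (simp add: h_def add_divide_distrib)
      qed
      finally show "q (u + v) \<le> q u + q v + d" using x y by simp
    qed
  next
    have "q 0 \<le> 0" using le[OF X0(1), of 0] by (simp add: h_def L0)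
    moreover have "q 0 \<ge> 0" unfolding q_def by (rule cINF_greatest[OF X0(2) h0])
    ultimately show "q 0 = 0" by simp
  next
    fix t :: real and v assume t: "t > 0"
    show "q (t *\<^sub>R v) \<le> t * q v"
    proof (rule field_le_epsilon)
      fix d :: real assume "d > 0"
      then obtain x where x: "x \<in> X" "h v x < q v + d / t" using less[of v "q v + d / t"] t by auto
      have "q (t *\<^sub>R v) \<le> h (t *\<^sub>R v) (t *\<^sub>R x)" by (rule le[OF subspace_scale[OF X x(1)]])
      also have "\<dots> = t * h v x"
        using t norm_scaleR[of t "v - L x"] L_scale[OF x(1), of t]
        by (simp add: h_def distrib_left scaleR_diff_right del: norm_scaleR) simp
      also have "\<dots> \<le> t * (q v + d / t)" using x t by (intro mult_left_mono) auto
      finally show "q (t *\<^sub>R v) \<le> t * q v + d" using t by (simp add: distrib_left)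
    qed
  qed
  then obtain f where f: "linear f" "\<And>v. f v \<le> q v" "f w = q w"
    by (rule hahn_banach_sublinear[of q w]) blast
  have neg: "f (- v) = - f v" for v by (rule linear_neg[OF f(1)])
  show ?thesis
  proof (rule that[OF f(1)])
    have "1 \<le> h w x" if x: "x \<in> X" for x
    proof (cases "norm x \<le> M")
      case True
      then have "1 \<le> norm (w - L x) / \<epsilon>" using far[OF x] \<epsilon> by simp
      moreover have "0 \<le> norm x / M" using M by simp
      ultimately show ?thesis unfolding h_def by linarith
    next
      case False
      then have "1 \<le> norm x / M" using M by simp
      moreover have "0 \<le> norm (w - L x) / \<epsilon>" using \<epsilon> by simp
      ultimately show ?thesis unfolding h_def by linarith
    qed
    then show "f w \<ge> 1" unfolding f(3) q_def by (rule cINF_greatest[OF X0(2)])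
    have fL: "f (L x) \<le> norm x / M" if x: "x \<in> X" for x
      using f(2)[of "L x"] le[OF x, of "L x"] by (simp add: h_def)
    show "\<bar>f (L x)\<bar> \<le> norm x / M" if x: "x \<in> X" for x
    proof -
      have "L (- x) = - L x" using L_scale[OF x, of "-1"] by simp
      then show ?thesis using fL[OF x] fL[OF subspace_neg[OF X x]] neg[of "L x"] by simp
    qed
    have fb: "f v \<le> norm v / \<epsilon>" for v
      using f(2)[of v] le[OF X0(1), of v] by (simp add: h_def L0)
    show "\<bar>f v\<bar> \<le> norm v / \<epsilon>" for v using fb[of v] fb[of "- v"] neg[of v] by simp
  qed
qed

text \<open>
  The usual passage from a real functional to a scalar one, written so that it also covers the
  real field, where \<open>i = 0\<close> removes the second term.
\<close>

lemma bounded_functional_complexify: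
  fixes T :: "('k::real_or_complex, 'u::real_normed_vector) dual_tower"
  assumes T: "space_at T k" and u: "linear u" "\<And>x. \<bar>u x\<bar> \<le> C * norm x"
    and i: "i = 0 \<or> i * i = -1" "\<And>z::'k. \<exists>a b. z = of_real a + of_real b * i"
  shows "bounded_functional (scal T) (lev T k) (\<lambda>x. of_real (u x) - of_real (u (scal T i x)) * i)"
    (is "bounded_functional _ _ ?\<phi>")
proof -
  note s = scal_simps[OF T] and lin = linear_add[OF u(1)] linear_scale[OF u(1)]
  have s0: "scal T 0 x = 0" and s1: "scal T (-1) x = - x" for x
    using s(1)[of 0 x] s(1)[of "-1" x] by simp_all
  have "?\<phi> (scal T c x) = c * ?\<phi> x" for c x
  proof -
    obtain a b where c: "c = of_real a + of_real b * i" using i(2) by blast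
    have r: "scal T (of_real b * i) y = b *\<^sub>R scal T i y" for y
      using s(6)[of "of_real b" i y] by (simp add: s(1))
    have cx: "scal T c y = a *\<^sub>R y + b *\<^sub>R scal T i y" for y
      unfolding c s(5) r by (simp add: s(1))
    from i(1) show ?thesis
    proof
      assume "i = 0"
      then show ?thesis unfolding cx by (simp add: c s0 lin)
    next
      assume ii: "i * i = -1"
      have icx: "scal T i (scal T c x) = a *\<^sub>R scal T i x - b *\<^sub>R x"
        unfolding cx s(3,4,6) by (simp add: ii s1)
      have "c * ?\<phi> x = of_real a * of_real (u x) + of_real b * of_real (u x) * i
          - of_real a * of_real (u (scal T i x)) * i - of_real b * of_real (u (scal T i x)) * (i * i)"
        by (simp add: c algebra_simps)
      also have "\<dots> = ?\<phi> (scal T c x)"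
        unfolding icx unfolding cx by (simp add: ii lin linear_diff[OF u(1)] algebra_simps)
      finally show ?thesis by simp
    qed
  qed
  moreover have "?\<phi> (x + y) = ?\<phi> x + ?\<phi> y" for x y
    by (simp add: s(3) lin algebra_simps)
  moreover have "norm (?\<phi> x) \<le> (C + C * norm i * norm i) * norm x" for x
  proof -
    have "norm (?\<phi> x) \<le> \<bar>u x\<bar> + \<bar>u (scal T i x)\<bar> * norm i"
      using norm_triangle_ineq4[of "of_real (u x)" "of_real (u (scal T i x)) * i"] by (simp add: norm_mult)
    also have "\<dots> \<le> C * norm x + C * norm (scal T i x) * norm i"
      by (intro add_mono mult_right_mono u) auto
    finally show ?thesis by (simp add: s(2) algebra_simps)
  qed
  ultimately show ?thesis unfolding bounded_functional_def by blast
qed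

text \<open>
  The hypotheses on \<open>e\<close> say that \<open>e\<close> acts as a unit in the weak sense: if \<open>e\<close> is the weak* limit of
  points \<open>x\<^sub>\<alpha>\<close>, then \<open>P a x\<^sub>\<alpha> \<rightarrow> a\<close> and \<open>D x\<^sub>\<alpha> y \<rightarrow> y\<close> weakly. Norm approximation, simultaneous for \<open>a\<close>
  and \<open>z\<close> and with a bound on \<open>x\<close>, follows by separation. Otherwise a functional \<open>(a', y')\<close> is at
  least \<open>1\<close> at \<open>(a, z)\<close> (in its real part), but \<open>x \<mapsto> \<langle>a', P a x\<rangle> + \<langle>y', D x z\<rangle>\<close> has norm at most
  \<open>2 / M\<close>. Evaluating \<open>e\<close> at the latter functional gives \<open>\<langle>a', a\<rangle> + \<langle>y', z\<rangle>\<close>, so this value is at most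
  \<open>2 * norm e / M\<close> in norm, which is too small. The factor \<open>4\<close> in \<open>M\<close> pays for the two factors \<open>2\<close> that come
  from complexification and from the estimate of the real part.
\<close>

lemma bidual_unit_approx:
  fixes A :: "('k::real_or_complex, 'a::real_normed_vector) dual_tower"
    and B :: "('k, 'b::real_normed_vector) dual_tower"
  assumes A: "dual_at A m" "dual_at A (Suc m)" and B: "dual_at B r"
    and P: "bilinear_at A m A m A m P" and D: "bilinear_at A m B r B r D"
    and e: "e \<in> lev A (Suc (Suc m))"
    and eP: "\<And>a a' f. a \<in> lev A m \<Longrightarrow> a' \<in> lev A (Suc m) \<Longrightarrow> f \<in> lev A (Suc m) \<Longrightarrow>
      (\<And>x. x \<in> lev A m \<Longrightarrow> pair A m f x = pair A m a' (P a x)) \<Longrightarrow> pair A (Suc m) e f = pair A m a' a"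
    and eD: "\<And>y y' f. y \<in> lev B r \<Longrightarrow> y' \<in> lev B (Suc r) \<Longrightarrow> f \<in> lev A (Suc m) \<Longrightarrow>
      (\<And>x. x \<in> lev A m \<Longrightarrow> pair A m f x = pair B r y' (D x y)) \<Longrightarrow> pair A (Suc m) e f = pair B r y' y"
    and a: "a \<in> lev A m" and z: "z \<in> lev B r" and \<epsilon>: "\<epsilon> > 0"
  shows "\<exists>x\<in>lev A m. norm x \<le> 4 * (norm e + 1) \<and> norm (P a x - a) < \<epsilon> \<and> norm (D x z - z) < \<epsilon>"
proof (rule ccontr)
  assume none: "\<not> ?thesis"
  define M where "M = 4 * (norm e + 1)"
  have M: "M > 0" by (simp add: M_def add_nonneg_pos)
  note sA = dual_at_space(1)[OF A(1)] and sB = dual_at_space(1)[OF B]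
  note subA = space_at_subspace[OF sA] and subB = space_at_subspace[OF sB]
  note Ps = bilinear_at_simps[OF P] and Ds = bilinear_at_simps[OF D]
  define L where "L x = (P a x, D x z)" for x
  have far: "norm ((a, z) - L x) \<ge> \<epsilon>" if "x \<in> lev A m" "norm x \<le> M" for x
  proof -
    have "\<epsilon> \<le> norm (P a x - a) \<or> \<epsilon> \<le> norm (D x z - z)" using none that by (force simp: M_def)
    moreover have "norm (P a x - a) \<le> norm ((a, z) - L x)" "norm (D x z - z) \<le> norm ((a, z) - L x)"
      using norm_fst_le[of "a - P a x" "z - D x z"] norm_snd_le[of "z - D x z" "a - P a x"]
      by (simp_all add: L_def norm_minus_commute)
    ultimately show ?thesis by linarith
  qed
  obtain \<phi> where \<phi>: "linear \<phi>" "\<phi> (a, z) \<ge> 1" "\<And>x. x \<in> lev A m \<Longrightarrow> \<bar>\<phi> (L x)\<bar> \<le> norm x / M"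
    "\<And>v. \<bar>\<phi> v\<bar> \<le> norm v / \<epsilon>"
  proof (rule separate_from_image_of_ball[where L = L, OF subA(7) _ _ M \<epsilon> far])
    show "L (x + y) = L x + L y" if "x \<in> lev A m" "y \<in> lev A m" for x y
      using that a z by (simp add: L_def Ps Ds)
    show "L (t *\<^sub>R x) = t *\<^sub>R L x" if "x \<in> lev A m" for t x
      using that a z bilinear_at_scaleR[OF P sA sA sA] bilinear_at_scaleR[OF D sA sB sB]
      by (simp add: L_def)
  qed (use that in blast)+
  define u where "u x = \<phi> (x, 0)" for x
  define v where "v y = \<phi> (0, y)" for y
  have uv: "\<phi> (x, y) = u x + v y" for x y
    using linear_add[OF \<phi>(1), of "(x, 0)" "(0, y)"] by (simp add: u_def v_def)
  have lin: "linear u" "linear v"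
    unfolding u_def v_def
    using linear_compose[OF _ \<phi>(1), of "\<lambda>x. (x, 0)"] linear_compose[OF _ \<phi>(1), of "\<lambda>y. (0, y)"]
    by (auto simp: linear_iff o_def)
  have bd: "\<bar>u x\<bar> \<le> (1 / \<epsilon>) * norm x" "\<bar>v y\<bar> \<le> (1 / \<epsilon>) * norm y" for x y
    using \<phi>(4)[of "(x, 0)"] \<phi>(4)[of "(0, y)"] by (simp_all add: u_def v_def norm_Pair)
  obtain i :: 'k where i: "i = 0 \<or> i * i = -1" "norm i \<le> 1" "\<And>z. \<exists>a b. z = of_real a + of_real b * i"
    "\<And>a b. \<bar>a\<bar> \<le> 2 * norm (of_real a + of_real b * i)"
    by (rule imaginary_unit) (rule that, assumption+)
  obtain a' where a': "a' \<in> lev A (Suc m)"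
    "\<And>x. x \<in> lev A m \<Longrightarrow> pair A m a' x = of_real (u x) - of_real (u (scal A i x)) * i"
    using dual_ex[OF A(1) bounded_functional_complexify[OF sA lin(1) bd(1) i(1,3)]] by blast
  obtain y' where y': "y' \<in> lev B (Suc r)"
    "\<And>y. y \<in> lev B r \<Longrightarrow> pair B r y' y = of_real (v y) - of_real (v (scal B i y)) * i"
    using dual_ex[OF B bounded_functional_complexify[OF sB lin(2) bd(2) i(1,3)]] by blast
  obtain f where f: "f \<in> lev A (Suc m)" "\<And>x. x \<in> lev A m \<Longrightarrow> pair A m f x = pair A m a' (P a x)"
    using dual_ex[OF A(1) bounded_functional_pair[OF A(1) P a'(1) a]] by blast
  obtain g where g: "g \<in> lev A (Suc m)" "\<And>x. x \<in> lev A m \<Longrightarrow> pair A m g x = pair B r y' (D x z)"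
    using dual_ex[OF A(1) bounded_functional_pair[OF B bilinear_at_swap[OF D] y'(1) z]] by blast
  have fg: "f + g \<in> lev A (Suc m)"
    using f g space_at_subspace(2)[OF dual_at_space(2)[OF A(1)]] by blast
  have "pair A (Suc m) e (f + g) = pair A m a' a + pair B r y' z"
    using eP[OF a a'(1) f] eD[OF z y'(1) g] pair_simps(1)[OF A(2) e f(1) g(1)] by simp
  also have "\<dots> = of_real (\<phi> (a, z)) + of_real (- \<phi> (scal A i a, scal B i z)) * i"
    by (simp add: a' a y' z uv algebra_simps)
  finally have "\<bar>\<phi> (a, z)\<bar> \<le> 2 * norm (pair A (Suc m) e (f + g))"
    by (simp only: i(4))
  also have "\<dots> \<le> 2 * (norm e * norm (f + g))"
    using pair_bound[OF A(2) e fg] by simp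
  also have "norm (f + g) \<le> 2 / M"
  proof (rule dual_norm_le[OF A(1) fg])
    fix x assume x: "x \<in> lev A m"
    have ix: "scal A i x \<in> lev A m" "norm (scal A i x) \<le> norm x"
      using x subA(3) i(2) scal_simps(2)[OF sA, of i x] mult_right_mono[OF i(2), of "norm x"] by auto
    have "pair A m (f + g) x = pair A m a' (P a x) + pair B r y' (D x z)"
      using pair_simps(4)[OF A(1) f(1) g(1) x] f(2)[OF x] g(2)[OF x] by simp
    also have "\<dots> = of_real (\<phi> (L x)) - of_real (\<phi> (L (scal A i x))) * i"
      using x a z a'(2)[of "P a x"] y'(2)[of "D x z"] by (simp add: Ps Ds uv L_def algebra_simps)
    finally have "norm (pair A m (f + g) x) \<le> \<bar>\<phi> (L x)\<bar> + \<bar>\<phi> (L (scal A i x))\<bar> * norm i"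
      using norm_triangle_ineq4[of "of_real (\<phi> (L x))" "of_real (\<phi> (L (scal A i x))) * i"]
      by (simp add: norm_mult)
    also have "\<dots> \<le> norm x / M + norm (scal A i x) / M * 1"
      using M by (intro add_mono mult_mono \<phi>(3) x ix i) auto
    also have "\<dots> \<le> norm x / M + norm x / M"
      using M ix(2) by (intro add_left_mono) (simp add: divide_right_mono)
    finally show "norm (pair A m (f + g) x) \<le> 2 / M * norm x" by simp
  qed (use M in simp)
  then have "2 * (norm e * norm (f + g)) \<le> 2 * (norm e * (2 / M))"
    by (intro mult_left_mono) auto
  also have "\<dots> = 4 * norm e / M" by simp
  also have "\<dots> < 1"
  proof -
    have "4 * norm e < M" by (simp add: M_def)
    then show ?thesis using M by (simp add: divide_less_eq)
  qed
  finally show False using \<phi>(2) by simp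
qed

lemma factorization_from_bidual_unit:
  fixes A :: "('k::real_or_complex, 'a::real_normed_vector) dual_tower"
    and B :: "('k, 'b::real_normed_vector) dual_tower"
  assumes A: "dual_at A m" "dual_at A (Suc m)" and B: "dual_at B r"
    and complete: "complete (lev A m)" "complete (lev B r)"
    and P: "bilinear_at A m A m A m P" and D: "bilinear_at A m B r B r D"
    and assoc: "\<And>a x y. a \<in> lev A m \<Longrightarrow> x \<in> lev A m \<Longrightarrow> y \<in> lev B r \<Longrightarrow> D (P a x) y = D a (D x y)"
    and e: "e \<in> lev A (Suc (Suc m))"
    and eP: "\<And>a a' f. a \<in> lev A m \<Longrightarrow> a' \<in> lev A (Suc m) \<Longrightarrow> f \<in> lev A (Suc m) \<Longrightarrow>
      (\<And>x. x \<in> lev A m \<Longrightarrow> pair A m f x = pair A m a' (P a x)) \<Longrightarrow> pair A (Suc m) e f = pair A m a' a"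
    and eD: "\<And>y y' f. y \<in> lev B r \<Longrightarrow> y' \<in> lev B (Suc r) \<Longrightarrow> f \<in> lev A (Suc m) \<Longrightarrow>
      (\<And>x. x \<in> lev A m \<Longrightarrow> pair A m f x = pair B r y' (D x y)) \<Longrightarrow> pair A (Suc m) e f = pair B r y' y"
  shows "products D (lev A m) (lev B r) = lev B r"
proof
  note sA = dual_at_space(1)[OF A(1)] and sB = dual_at_space(1)[OF B]
  note subA = space_at_subspace[OF sA] and subB = space_at_subspace[OF sB]
  note Ps = bilinear_at_simps[OF P] and Ds = bilinear_at_simps[OF D]
  show "products D (lev A m) (lev B r) \<subseteq> lev B r" using Ds(1) by (auto simp: products_def)
  obtain K where K: "K \<ge> 0" "\<And>x y. x \<in> lev A m \<Longrightarrow> y \<in> lev B r \<Longrightarrow> norm (D x y) \<le> K * norm x * norm y"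
    using bilinear_at_bound[OF D] by blast
  show "lev B r \<subseteq> products D (lev A m) (lev B r)"
  proof
    fix y assume y: "y \<in> lev B r"
    obtain a z where "a \<in> lev A m" "z \<in> lev B r" "D a z = y"
    proof (rule cohen_factorization[OF subA(7) complete(1) subB(7) complete(2), of P D K "4 * (norm e + 1)" y])
      show "\<exists>x\<in>lev A m. norm x \<le> 4 * (norm e + 1) \<and> norm (P a x - a) < \<epsilon> \<and> norm (D x z - z) < \<epsilon>"
        if "a \<in> lev A m" "z \<in> lev B r" "\<epsilon> > 0" for a z \<epsilon>
        by (rule bidual_unit_approx[OF A B P D e eP eD that])
    qed (use K y that in \<open>simp_all add: Ps Ds assoc bilinear_at_scaleR[OF D sA sB sB]\<close>)
    then show "y \<in> products D (lev A m) (lev B r)" unfolding products_def by blast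
  qed
qed

section \<open>Point continuity at a unit of the bidual\<close>

lemma openin_weak_eval:
  assumes "dual_at T k" "dual_at T (Suc k)" "dual_at T (Suc (Suc k))" "y \<in> lev T (Suc k)" "open V"
  shows "openin (weak T (Suc (Suc k))) {b \<in> lev T (Suc (Suc k)). pair T (Suc k) b y \<in> V}"
proof -
  note c = canon[OF assms(2,3,4)]
  have "{b \<in> lev T (Suc (Suc k)). pair T (Suc k) b y \<in> V} =
      {b \<in> lev T (Suc (Suc k)). pair T (Suc (Suc k)) (canon T (Suc k) y) b \<in> V}"
    using c(2) by auto
  then show ?thesis using openin_weak[OF c(1) assms(5)] by simp
qed

text \<open>
  On \<open>A\<^sup>(\<^sup>m\<^sup>)\<close> the map \<open>T\<^sup>*\<^sup>*\<close> is the dual module action, so the Arens extension of an action is, on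
  canonical images, the pairing with translates of \<open>y\<close>.
\<close>

lemma adj2_canon_eq_adjoint:
  assumes A: "dual_at A m" "dual_at A (Suc m)" and B: "dual_at B m" "dual_at B (Suc m)"
    and T: "bilinear_at B m A m B m T" and x: "x \<in> lev A m" and y: "y \<in> lev B (Suc m)"
  shows "adj2 B A B m T (canon A m x) y = adj1 B m B (\<lambda>a b. T b a) y x"
proof (rule dual_eqI[OF B(1)])
  note Ts = bilinear_at_swap[OF T]
  note adj = adjoint[OF B(1) B(1) Ts y x]
  show "adj2 B A B m T (canon A m x) y \<in> lev B (Suc m)"
    by (rule adj2_in[OF B A B T canon(1)[OF A x] y])
  show "adj1 B m B (\<lambda>a b. T b a) y x \<in> lev B (Suc m)" by (rule adj(1))
  show "pair B m (adj2 B A B m T (canon A m x) y) b = pair B m (adj1 B m B (\<lambda>a b. T b a) y x) b"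
    if "b \<in> lev B m" for b
    using adj2_canon[OF B A B T x y that] adj(2)[OF that] by simp
qed

text \<open>
  Both \<open>\<langle>a, f\<rangle>\<close> and \<open>\<langle>T\<^sup>*\<^sup>*\<^sup>* y' a, y\<rangle>\<close> are functions of \<open>a\<close> that agree on the dense image of \<open>A\<^sup>(\<^sup>m\<^sup>)\<close>.
  The first is weak* continuous and the second is continuous at \<open>e\<close>, so they agree at \<open>e\<close>. The
  topology \<open>\<tau>\<close> is kept abstract in order to serve the weak* and the weak topology alike.
\<close>

lemma pairing_by_continuity:
  assumes A: "dual_at A m" "dual_at A (Suc m)" and B: "dual_at B m" "dual_at B (Suc m)"
    and T: "bilinear_at B m A m B m T" and e: "e \<in> lev A (Suc (Suc m))"
    and y: "y \<in> lev B (Suc m)" and y': "y' \<in> lev B (Suc (Suc m))" and f: "f \<in> lev A (Suc m)"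
    and feq: "\<And>x. x \<in> lev A m \<Longrightarrow> pair A m f x = pair B (Suc m) y' (adj1 B m B (\<lambda>a b. T b a) y x)"
    and open_eval: "\<And>V. open V \<Longrightarrow> openin \<tau> {b \<in> lev B (Suc (Suc m)). pair B (Suc m) b y \<in> V}"
    and cont: "point_continuous (weak_star A (Suc (Suc m))) \<tau> (\<lambda>a. arens B A B m T y' a) e"
  shows "pair A (Suc m) e f = pair B (Suc m) (arens B A B m T y' e) y"
proof (rule ccontr)
  let ?c = "pair A (Suc m) e f"
  let ?V = "{b \<in> lev B (Suc (Suc m)). pair B (Suc m) b y \<in> - {?c}}"
  assume "\<not> ?thesis"
  then have "arens B A B m T y' e \<in> ?V" using arens_in[OF B A B T y' e] by auto
  moreover have "openin \<tau> ?V" by (rule open_eval) auto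
  moreover have "e \<in> topspace (weak_star A (Suc (Suc m)))" using e by (simp add: topspace_weak_star)
  ultimately obtain U where U: "openin (weak_star A (Suc (Suc m))) U" "e \<in> U"
    "\<And>a. a \<in> U \<Longrightarrow> arens B A B m T y' a \<in> ?V"
    using point_continuous_nbhd[OF cont] by blast
  obtain x where x: "x \<in> lev A m" "canon A m x \<in> U" "pair A m f x = ?c"
    using canon_dense[OF A e U(1,2) f] by blast
  have "pair B (Suc m) (arens B A B m T y' (canon A m x)) y = pair A m f x"
    using pair_arens[OF B A B T y' canon(1)[OF A x(1)] y] adj2_canon_eq_adjoint[OF A B T x(1) y]
      feq[OF x(1)] by simp
  with x U(3)[OF x(2)] show False by simp
qed

text \<open>
  If \<open>canon x\<^sub>\<alpha> \<rightarrow> e\<close> weak*, then \<open>\<langle>x\<^sub>\<alpha> c, b\<rangle> = \<langle>c, F b x\<^sub>\<alpha>\<rangle> \<rightarrow> \<langle>c, F b e\<rangle> = \<langle>c, b\<rangle>\<close> by weak continuity, that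
  is, \<open>x\<^sub>\<alpha> c \<rightarrow> c\<close> weak*. A basic neighbourhood of \<open>c\<close> involves finitely many \<open>b\<close>, so finitely many
  neighbourhoods of \<open>e\<close> are intersected.
\<close>

lemma weak_star_closure_of_action:
  assumes A: "dual_at A m" "dual_at A (Suc m)" and e: "e \<in> lev A (Suc (Suc m))"
    and S: "S \<subseteq> lev B (Suc k)"
      "\<And>x c. x \<in> lev A m \<Longrightarrow> c \<in> lev B (Suc k) \<Longrightarrow> G (canon A m x) c \<in> S"
    and pair_G: "\<And>a b c. a \<in> lev A (Suc (Suc m)) \<Longrightarrow> b \<in> lev B k \<Longrightarrow> c \<in> lev B (Suc k) \<Longrightarrow>
      pair B k (G a c) b = pair B k c (F b a)"
    and F: "\<And>a b. a \<in> lev A (Suc (Suc m)) \<Longrightarrow> b \<in> lev B k \<Longrightarrow> F b a \<in> lev B k"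
    and unit: "\<And>b. b \<in> lev B k \<Longrightarrow> F b e = b"
    and cont: "\<And>b. b \<in> lev B k \<Longrightarrow> point_continuous (weak_star A (Suc (Suc m))) (weak B k) (F b) e"
  shows "weak_star B (Suc k) closure_of S = lev B (Suc k)"
proof
  show "weak_star B (Suc k) closure_of S \<subseteq> lev B (Suc k)"
    using closure_of_subset_topspace[of "weak_star B (Suc k)" S] by (simp add: topspace_weak_star)
  let ?\<tau> = "weak_star A (Suc (Suc m))"
  have eT: "e \<in> topspace ?\<tau>" using e by (simp add: topspace_weak_star)
  show "lev B (Suc k) \<subseteq> weak_star B (Suc k) closure_of S"
  proof
    fix c assume c: "c \<in> lev B (Suc k)"
    have "\<exists>s. s \<in> S \<and> s \<in> W" if W: "openin (weak_star B (Suc k)) W" "c \<in> W" for W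
    proof -
      obtain I N where I: "finite I" "I \<subseteq> lev B k"
        and N: "\<And>b. b \<in> I \<Longrightarrow> open (N b) \<and> pair B k c b \<in> N b"
        and sub: "\<And>d. d \<in> lev B (Suc k) \<Longrightarrow> (\<And>b. b \<in> I \<Longrightarrow> pair B k d b \<in> N b) \<Longrightarrow> d \<in> W"
        using weak_star_nbhd[OF W] by blast
      have "\<exists>U. openin ?\<tau> U \<and> e \<in> U \<and> (\<forall>a\<in>U. pair B k c (F b a) \<in> N b)" if b: "b \<in> I" for b
      proof -
        have bk: "b \<in> lev B k" using b I by blast
        have op: "openin (weak B k) {d \<in> lev B k. pair B k c d \<in> N b}"
          using openin_weak[OF c] N[OF b] by blast
        have "F b e \<in> {d \<in> lev B k. pair B k c d \<in> N b}"
          using unit[OF bk] N[OF b] bk by simp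
        from point_continuous_nbhd[OF cont[OF bk] eT op this]
        obtain U where "openin ?\<tau> U" "e \<in> U" "\<And>a. a \<in> U \<Longrightarrow> F b a \<in> {d \<in> lev B k. pair B k c d \<in> N b}"
          by blast
        then show ?thesis by (intro exI[of _ U]) simp
      qed
      then have "\<forall>b\<in>I. \<exists>U. openin ?\<tau> U \<and> e \<in> U \<and> (\<forall>a\<in>U. pair B k c (F b a) \<in> N b)" by blast
      from bchoice[OF this] obtain U where U: "\<And>b. b \<in> I \<Longrightarrow> openin ?\<tau> (U b) \<and> e \<in> U b"
        "\<And>b a. b \<in> I \<Longrightarrow> a \<in> U b \<Longrightarrow> pair B k c (F b a) \<in> N b" by blast
      have "openin ?\<tau> ((\<Inter>b\<in>I. U b) \<inter> topspace ?\<tau>)" using I U by (intro openin_INT) auto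
      moreover have "e \<in> (\<Inter>b\<in>I. U b) \<inter> topspace ?\<tau>" using U eT by blast
      ultimately have nbhd: "openin ?\<tau> ((\<Inter>b\<in>I. U b) \<inter> topspace ?\<tau>)"
        "e \<in> (\<Inter>b\<in>I. U b) \<inter> topspace ?\<tau>" by blast+
      from canon_dense[OF A e nbhd space_at_subspace(1)[OF dual_at_space(2)[OF A(1)]]]
      obtain x where x: "x \<in> lev A m" "canon A m x \<in> (\<Inter>b\<in>I. U b) \<inter> topspace ?\<tau>"
        by blast
      have xA: "canon A m x \<in> lev A (Suc (Suc m))" by (rule canon[OF A x(1)])
      have GS: "G (canon A m x) c \<in> S" by (rule S(2)[OF x(1) c])
      have "G (canon A m x) c \<in> W"
      proof (rule sub)
        show "G (canon A m x) c \<in> lev B (Suc k)" using GS S(1) by blast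
        fix b assume b: "b \<in> I"
        then have "pair B k (G (canon A m x) c) b = pair B k c (F b (canon A m x))"
          using pair_G[OF xA _ c] I by blast
        then show "pair B k (G (canon A m x) c) b \<in> N b" using U(2)[OF b] x(2) b by auto
      qed
      with GS show ?thesis by blast
    qed
    then show "c \<in> weak_star B (Suc k) closure_of S"
      using c by (auto simp: in_closure_of topspace_weak_star)
  qed
qed

section \<open>The factorization theorem\<close>

lemma iterated_duals_mono: "iterated_duals T h \<Longrightarrow> k \<le> h \<Longrightarrow> iterated_duals T k"
  by (simp add: iterated_duals_def)

theorem mainTheorem5:
  fixes A :: "('k::real_or_complex, 'a::real_normed_vector) dual_tower"
    and B :: "('k, 'b::real_normed_vector) dual_tower"
    and mul :: "'a \<Rightarrow> 'a \<Rightarrow> 'a"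
    and pl :: "'a \<Rightarrow> 'b \<Rightarrow> 'b"
    and pr :: "'b \<Rightarrow> 'a \<Rightarrow> 'b"
    and n :: nat
  assumes "n \<ge> 2" "even n"
    and "iterated_duals A n" "iterated_duals B (n + 1)"
    and "banach_algebra A mul"
    and "banach_bimodule A mul B pl pr"
  shows
    "(\<forall>e. right_unit A mul B pr n e \<and> Zl A B pr n e = lev B n \<longrightarrow>
        products (dual_lact A B pr (n - 2)) (lev A (n - 2)) (lev B (n - 1)) = lev B (n - 1)) \<and>
     (\<forall>e. left_unit A mul B pl n e \<and> Zr A B pl n e = lev B n \<longrightarrow>
        products (dual_ract A B pl (n - 2)) (lev B (n - 1)) (lev A (n - 2)) = lev B (n - 1)) \<and>
     (\<forall>e. right_unit A mul B pr n e \<and> Zl_weak A B pr n e = lev B n \<longrightarrow>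
        products (dual_lact A B pr (n - 2)) (lev A (n - 2)) (lev B (n - 1)) = lev B (n - 1) \<and>
        weak_star B (n + 1) closure_of
          products (dual_lact A B pr n) (canon A (n - 2) ` lev A (n - 2)) (lev B (n + 1))
          = lev B (n + 1)) \<and>
     (\<forall>e. left_unit A mul B pl n e \<and> Zr_weak A B pl n e = lev B n \<longrightarrow>
        products (dual_ract A B pl (n - 2)) (lev B (n - 1)) (lev A (n - 2)) = lev B (n - 1) \<and>
        weak_star B (n + 1) closure_of
          products (dual_ract A B pl n) (lev B (n + 1)) (canon A (n - 2) ` lev A (n - 2))
          = lev B (n + 1))"
proof -
  obtain m where m: "n = Suc (Suc m)"
    using \<open>n \<ge> 2\<close> by (metis Suc_diff_Suc add_2_eq_Suc le_add_diff_inverse)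
  have em: "even m" using \<open>even n\<close> m by simp
  have TA: "iterated_duals A n" and TB: "iterated_duals B n"
    using assms(3,4) iterated_duals_mono[of B "n + 1" n] by auto
  have mn: "m \<le> n" "n \<le> n" by (simp_all add: m)
  have A: "dual_at A m" "dual_at A (Suc m)"
    using iterated_duals_levels(1)[OF assms(3)] by (simp_all add: m)
  have B: "dual_at B m" "dual_at B (Suc m)" "dual_at B n"
    using iterated_duals_levels(1)[OF assms(4)] by (simp_all add: m)
  have compl: "complete (lev A m)" "complete (lev B (Suc m))"
    using iterated_duals_levels(3)[OF assms(3), of m] iterated_duals_levels(3)[OF assms(4), of "Suc m"]
    by (simp_all add: m)
  have bb: "bounded_bilinear_on A A A mul" "bounded_bilinear_on A B B pl" "bounded_bilinear_on B A B pr"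
    using assms(5,6) by (auto simp: banach_algebra_def banach_bimodule_def)
  define P where "P = amul A mul m"
  define L where "L = lact A B pl m"
  define R where "R = ract A B pr m"
  have P: "bilinear_at A m A m A m P" and L: "bilinear_at A m B m B m L" and R: "bilinear_at B m A m B m R"
    unfolding P_def L_def R_def amul_def lact_def ract_def
    using bilinear_arens_iter[OF TA TA TA bb(1) em mn(1)] bilinear_arens_iter[OF TA TB TB bb(2) em mn(1)]
      bilinear_arens_iter[OF TB TA TB bb(3) em mn(1)] by auto
  note Ps = bilinear_at_simps[OF P] and Ls = bilinear_at_simps[OF L] and Rs = bilinear_at_simps[OF R]
  have up: "amul A mul n = arens A A A m P" "lact A B pl n = arens A B B m L" "ract A B pr n = arens B A B m R"
    by (simp_all add: m P_def L_def R_def amul_def lact_def ract_def)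
  note up' = up[unfolded m]
  have Rassoc: "R (R b x) y = R b (P x y)" if "b \<in> lev B m" "x \<in> lev A m" "y \<in> lev A m" for b x y
    unfolding R_def P_def ract_def amul_def
    by (rule arens_iter_assoc[OF TB TA TA TB TA TB bb(3) bb(3) bb(3) bb(1) _ em mn(1) that])
      (use assms(6) in \<open>simp add: banach_bimodule_def\<close>)
  have Lassoc: "L (P x y) b = L x (L y b)" if "x \<in> lev A m" "y \<in> lev A m" "b \<in> lev B m" for b x y
    unfolding L_def P_def lact_def amul_def
    by (rule arens_iter_assoc[OF TA TA TB TA TB TB bb(2) bb(1) bb(2) bb(2) _ em mn(1) that])
      (use assms(6) in \<open>simp add: banach_bimodule_def\<close>)
  define Dl where "Dl = dual_lact A B pr m"
  define Dr where "Dr = dual_ract A B pl m"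
  have Dl_eq: "Dl a y = adj1 B m B (\<lambda>a b. R b a) y a" and Dr_eq: "Dr y a = adj1 B m B L y a" for a y
    by (simp_all add: Dl_def Dr_def dual_lact_def dual_ract_def R_def L_def)
  note sA = dual_at_space(1)[OF A(1)]
  have Dl: "bilinear_at A m B (Suc m) B (Suc m) Dl"
    using bilinear_at_swap[OF bilinear_at_adjoint[OF sA B(1,1) bilinear_at_swap[OF R]]]
    by (simp add: Dl_eq[abs_def])
  have Dr: "bilinear_at A m B (Suc m) B (Suc m) (\<lambda>a y. Dr y a)"
    using bilinear_at_swap[OF bilinear_at_adjoint[OF sA B(1,1) L]] by (simp add: Dr_eq)
  have pair_Dl: "pair B m (Dl a y) b = pair B m y (R b a)"
    if "a \<in> lev A m" "y \<in> lev B (Suc m)" "b \<in> lev B m" for a y b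
    unfolding Dl_eq by (rule adjoint(2)[OF B(1,1) bilinear_at_swap[OF R] that(2,1,3)])
  have pair_Dr: "pair B m (Dr y a) b = pair B m y (L a b)"
    if "a \<in> lev A m" "y \<in> lev B (Suc m)" "b \<in> lev B m" for a y b
    unfolding Dr_eq by (rule adjoint(2)[OF B(1,1) L that(2,1,3)])
  have Dl_assoc: "Dl (P a x) y = Dl a (Dl x y)" if "a \<in> lev A m" "x \<in> lev A m" "y \<in> lev B (Suc m)" for a x y
    by (rule dual_eqI[OF B(1)])
      (use that in \<open>simp_all add: bilinear_at_simps(1)[OF Dl] Ps Rs pair_Dl Rassoc\<close>)
  have Dr_assoc: "Dr y (P x a) = Dr (Dr y x) a" if "a \<in> lev A m" "x \<in> lev A m" "y \<in> lev B (Suc m)" for a x y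
    by (rule dual_eqI[OF B(1)])
      (use that in \<open>simp_all add: bilinear_at_simps(1)[OF Dr] Ps Ls pair_Dr Lassoc\<close>)

  \<comment> \<open>A right unit of \<open>A\<^sup>(\<^sup>n\<^sup>)\<close> yields approximate units on the right of \<open>A\<^sup>(\<^sup>n\<^sup>-\<^sup>2\<^sup>)\<close>, and continuity at \<open>e\<close>
    yields approximate units for the left action on \<open>B\<^sup>(\<^sup>n\<^sup>-\<^sup>1\<^sup>)\<close>.\<close>
  have left_factor: "products Dl (lev A m) (lev B (Suc m)) = lev B (Suc m)"
    if e: "right_unit A mul B pr n e"
      and open_eval: "\<And>y V. y \<in> lev B (Suc m) \<Longrightarrow> open V \<Longrightarrow>
        openin \<tau> {b \<in> lev B (Suc (Suc m)). pair B (Suc m) b y \<in> V}"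
      and cont: "\<And>b. b \<in> lev B n \<Longrightarrow>
        point_continuous (weak_star A n) \<tau> (\<lambda>a. ract A B pr n b a) e" for e \<tau>
  proof (rule factorization_from_bidual_unit[OF A B(2) compl P Dl Dl_assoc])
    show eA: "e \<in> lev A (Suc (Suc m))" using e by (simp add: right_unit_def m)
    show "pair A (Suc m) e f = pair A m a' a"
      if a: "a \<in> lev A m" and a': "a' \<in> lev A (Suc m)" and f: "f \<in> lev A (Suc m)"
        and feq: "\<And>x. x \<in> lev A m \<Longrightarrow> pair A m f x = pair A m a' (P a x)" for a a' f
    proof -
      have "f = adj1 A m A P a' a"
        by (rule dual_eqI[OF A(1) f adj1_in[OF A A A P a' a]])
          (simp add: feq pair_adj1[OF A A A P a' a])
      then have "pair A (Suc m) e f = pair A (Suc m) (arens A A A m P (canon A m a) e) a'"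
        using arens_canon_left[OF A A A P a eA a'] by simp
      also have "arens A A A m P (canon A m a) e = canon A m a"
        using e canon(1)[OF A a] by (simp add: right_unit_def up' m)
      finally show ?thesis using canon(2)[OF A a a'] by simp
    qed
    show "pair A (Suc m) e f = pair B (Suc m) y' y"
      if y: "y \<in> lev B (Suc m)" and y': "y' \<in> lev B (Suc (Suc m))" and f: "f \<in> lev A (Suc m)"
        and feq: "\<And>x. x \<in> lev A m \<Longrightarrow> pair A m f x = pair B (Suc m) y' (Dl x y)" for y y' f
    proof -
      have "pair A (Suc m) e f = pair B (Suc m) (arens B A B m R y' e) y"
      proof (rule pairing_by_continuity[OF A B(1,2) R eA y y' f _ open_eval[OF y]])
        show "point_continuous (weak_star A (Suc (Suc m))) \<tau> (\<lambda>a. arens B A B m R y' a) e"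
          using cont[of y'] y' by (simp add: up' m)
      qed (simp_all add: feq Dl_eq)
      also have "arens B A B m R y' e = y'"
        using e y' by (simp add: right_unit_def up' m)
      finally show ?thesis .
    qed
  qed

  \<comment> \<open>The mirror image: \<open>B\<^sup>(\<^sup>n\<^sup>-\<^sup>1\<^sup>)\<close> is a left module over the opposite algebra of \<open>A\<^sup>(\<^sup>n\<^sup>-\<^sup>2\<^sup>)\<close>.\<close>
  have right_factor: "products Dr (lev B (Suc m)) (lev A m) = lev B (Suc m)"
    if e: "left_unit A mul B pl n e"
      and eD: "\<And>y y' f. y \<in> lev B (Suc m) \<Longrightarrow> y' \<in> lev B (Suc (Suc m)) \<Longrightarrow> f \<in> lev A (Suc m) \<Longrightarrow>
        (\<And>x. x \<in> lev A m \<Longrightarrow> pair A m f x = pair B (Suc m) y' (Dr y x)) \<Longrightarrow>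
        pair A (Suc m) e f = pair B (Suc m) y' y" for e
  proof -
    have "products (\<lambda>a y. Dr y a) (lev A m) (lev B (Suc m)) = lev B (Suc m)"
    proof (rule factorization_from_bidual_unit[OF A B(2) compl bilinear_at_swap[OF P] Dr Dr_assoc _ _ eD])
      show eA: "e \<in> lev A (Suc (Suc m))" using e by (simp add: left_unit_def m)
      show "pair A (Suc m) e f = pair A m a' a"
        if a: "a \<in> lev A m" and a': "a' \<in> lev A (Suc m)" and f: "f \<in> lev A (Suc m)"
          and feq: "\<And>x. x \<in> lev A m \<Longrightarrow> pair A m f x = pair A m a' (P x a)" for a a' f
      proof -
        note ca = canon[OF A a]
        have "f = adj2 A A A m P (canon A m a) a'"
          by (rule dual_eqI[OF A(1) f adj2_in[OF A A A P ca(1) a']])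
            (simp add: feq adj2_canon[OF A A A P a a'])
        then have "pair A (Suc m) e f = pair A (Suc m) (arens A A A m P e (canon A m a)) a'"
          using pair_arens[OF A A A P eA ca(1) a'] by simp
        also have "arens A A A m P e (canon A m a) = canon A m a"
          using e ca(1) by (simp add: left_unit_def up' m)
        finally show ?thesis using ca(2)[OF a'] by simp
      qed
    qed auto
    moreover have "products Dr (lev B (Suc m)) (lev A m) = products (\<lambda>a y. Dr y a) (lev A m) (lev B (Suc m))"
      by (auto simp: products_def)
    ultimately show ?thesis by simp
  qed

  have part1: "products Dl (lev A m) (lev B (Suc m)) = lev B (Suc m)"
    if "right_unit A mul B pr n e" and Z: "Zl A B pr n e = lev B n" for e
  proof (rule left_factor[OF that(1), of "weak_star B n"])
    show "openin (weak_star B n) {b \<in> lev B (Suc (Suc m)). pair B (Suc m) b y \<in> V}"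
      if "y \<in> lev B (Suc m)" "open V" for y V
      using openin_weak_star[OF that] by (simp add: m)
    show "point_continuous (weak_star A n) (weak_star B n) (\<lambda>a. ract A B pr n b a) e" if "b \<in> lev B n" for b
      using Z that by (auto simp: Zl_def)
  qed

  have part2: "products Dr (lev B (Suc m)) (lev A m) = lev B (Suc m)"
    if e: "left_unit A mul B pl n e" and Z: "Zr A B pl n e = lev B n" for e
  proof (rule right_factor[OF e])
    fix y y' f
    assume y: "y \<in> lev B (Suc m)" and y': "y' \<in> lev B (Suc (Suc m))" and f: "f \<in> lev A (Suc m)"
      and feq: "\<And>x. x \<in> lev A m \<Longrightarrow> pair A m f x = pair B (Suc m) y' (Dr y x)"
    let ?T = "\<lambda>b a. L a b"
    note T = bilinear_at_swap[OF L]
    have eA: "e \<in> lev A (Suc (Suc m))" using e by (simp add: left_unit_def m)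
    have "pair A (Suc m) e f = pair B (Suc m) (arens B A B m ?T y' e) y"
    proof (rule pairing_by_continuity[OF A B(1,2) T eA y y' f])
      show "openin (weak_star B n) {b \<in> lev B (Suc (Suc m)). pair B (Suc m) b y \<in> V}" if "open V" for V
        using openin_weak_star[OF y that] by (simp add: m)
      have "y' \<in> Zr A B pl n e" using y' Z by (simp add: m)
      then show "point_continuous (weak_star A (Suc (Suc m))) (weak_star B n) (\<lambda>a. arens B A B m ?T y' a) e"
        by (simp add: Zr_def m L_def)
    qed (simp add: feq Dr_eq)
    also have "\<dots> = pair B (Suc m) y' (adj2 B A B m ?T e y)"
      by (rule pair_arens[OF B(1,2) A B(1,2) T y' eA y])
    \<comment> \<open>The unit law concerns \<open>\<pi>\<^sub>\<ell>\<^sup>*\<^sup>*\<^sup>*\<close>, not the extension of the transposed action; applied to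
      canonical images of \<open>b\<close> it says that \<open>e\<close> fixes \<open>y\<close>.\<close>
    also have "adj2 B A B m ?T e y = y"
    proof (rule dual_eqI[OF B(1) adj2_in[OF B(1,2) A B(1,2) T eA y] y])
      fix b assume b: "b \<in> lev B m"
      note cb = canon[OF B(1,2) b]
      have eq: "adj1 A m B ?T y b = adj2 A B B m L (canon B m b) y"
        by (rule dual_eqI[OF A(1) adj1_in[OF B(1,2) A B(1,2) T y b] adj2_in[OF A B(1,2) B(1,2) L cb(1) y]])
          (simp add: pair_adj1[OF B(1,2) A B(1,2) T y b] adj2_canon[OF A B(1,2) B(1,2) L b y])
      have "pair B m (adj2 B A B m ?T e y) b = pair A (Suc m) e (adj2 A B B m L (canon B m b) y)"
        using pair_adj2[OF B(1,2) A B(1,2) T eA y b] eq by simp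
      also have "\<dots> = pair B (Suc m) (arens A B B m L e (canon B m b)) y"
        by (rule pair_arens[OF A B(1,2) B(1,2) L eA cb(1) y, symmetric])
      also have "arens A B B m L e (canon B m b) = canon B m b"
        using e cb(1) by (simp add: left_unit_def up' m)
      finally show "pair B m (adj2 B A B m ?T e y) b = pair B m y b" using cb(2)[OF y] by simp
    qed
    finally show "pair A (Suc m) e f = pair B (Suc m) y' y" .
  qed

  have Rn: "bilinear_at B n A n B n (ract A B pr n)" and Ln: "bilinear_at A n B n B n (lact A B pl n)"
    using bilinear_arens[OF B(1,2) A B(1,2) R] bilinear_arens[OF A B(1,2) B(1,2) L] by (simp_all add: up' m)

  have part3: "weak_star B (Suc n) closure_of
      products (dual_lact A B pr n) (canon A m ` lev A m) (lev B (Suc n)) = lev B (Suc n)"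
    if e: "right_unit A mul B pr n e" and Z: "Zl_weak A B pr n e = lev B n" for e
  proof (rule weak_star_closure_of_action[OF A, of e _ B n "dual_lact A B pr n" "ract A B pr n"])
    note adj = adjoint[OF B(3,3) bilinear_at_swap[OF Rn]]
    show "e \<in> lev A (Suc (Suc m))" using e by (simp add: right_unit_def m)
    show "products (dual_lact A B pr n) (canon A m ` lev A m) (lev B (Suc n)) \<subseteq> lev B (Suc n)"
      using canon(1)[OF A] adj(1) by (auto simp: products_def dual_lact_def m)
    show "pair B n (dual_lact A B pr n a c) b = pair B n c (ract A B pr n b a)"
      if "a \<in> lev A (Suc (Suc m))" "b \<in> lev B n" "c \<in> lev B (Suc n)" for a b c
      unfolding dual_lact_def using adj(2)[of c a b] that by (simp add: m)
    show "ract A B pr n b a \<in> lev B n" if "a \<in> lev A (Suc (Suc m))" "b \<in> lev B n" for a b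
      using bilinear_at_simps(1)[OF Rn] that by (simp add: m)
    show "ract A B pr n b e = b" if "b \<in> lev B n" for b using e that by (simp add: right_unit_def)
    show "point_continuous (weak_star A (Suc (Suc m))) (weak B n) (ract A B pr n b) e" if "b \<in> lev B n" for b
      using Z that by (auto simp: Zl_weak_def m)
  qed (auto simp: products_def)

  have part3': "products Dl (lev A m) (lev B (Suc m)) = lev B (Suc m)"
    if "right_unit A mul B pr n e" and Z: "Zl_weak A B pr n e = lev B n" for e
  proof (rule left_factor[OF that(1), of "weak B n"])
    show "openin (weak B n) {b \<in> lev B (Suc (Suc m)). pair B (Suc m) b y \<in> V}"
      if "y \<in> lev B (Suc m)" "open V" for y V
      using openin_weak_eval[OF B(1,2) _ that] B(3) by (simp add: m)
    show "point_continuous (weak_star A n) (weak B n) (\<lambda>a. ract A B pr n b a) e" if "b \<in> lev B n" for b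
      using Z that by (auto simp: Zl_weak_def)
  qed

  have part4: "weak_star B (Suc n) closure_of
      products (dual_ract A B pl n) (lev B (Suc n)) (canon A m ` lev A m) = lev B (Suc n)"
    if e: "left_unit A mul B pl n e" and Z: "Zr_weak A B pl n e = lev B n" for e
  proof (rule weak_star_closure_of_action[OF A, of e _ B n "\<lambda>a c. dual_ract A B pl n c a" "\<lambda>b a. lact A B pl n a b"])
    note adj = adjoint[OF B(3,3) Ln]
    show "e \<in> lev A (Suc (Suc m))" using e by (simp add: left_unit_def m)
    show "products (dual_ract A B pl n) (lev B (Suc n)) (canon A m ` lev A m) \<subseteq> lev B (Suc n)"
      using canon(1)[OF A] adj(1) by (auto simp: products_def dual_ract_def m)
    show "pair B n (dual_ract A B pl n c a) b = pair B n c (lact A B pl n a b)"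
      if "a \<in> lev A (Suc (Suc m))" "b \<in> lev B n" "c \<in> lev B (Suc n)" for a b c
      unfolding dual_ract_def using adj(2)[of c a b] that by (simp add: m)
    show "lact A B pl n a b \<in> lev B n" if "a \<in> lev A (Suc (Suc m))" "b \<in> lev B n" for a b
      using bilinear_at_simps(1)[OF Ln] that by (simp add: m)
    show "lact A B pl n e b = b" if "b \<in> lev B n" for b using e that by (simp add: left_unit_def)
    show "point_continuous (weak_star A (Suc (Suc m))) (weak B n) (\<lambda>a. lact A B pl n a b) e" if "b \<in> lev B n" for b
      using Z that by (auto simp: Zr_weak_def m)
  qed (auto simp: products_def)

  have part4': "products Dr (lev B (Suc m)) (lev A m) = lev B (Suc m)"
    if e: "left_unit A mul B pl n e" for e
  proof (rule right_factor[OF e])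
    fix y y' f
    assume y: "y \<in> lev B (Suc m)" and y': "y' \<in> lev B (Suc (Suc m))" and f: "f \<in> lev A (Suc m)"
      and feq: "\<And>x. x \<in> lev A m \<Longrightarrow> pair A m f x = pair B (Suc m) y' (Dr y x)"
    have eA: "e \<in> lev A (Suc (Suc m))" using e by (simp add: left_unit_def m)
    have "f = adj2 A B B m L y' y"
      by (rule dual_eqI[OF A(1) f adj2_in[OF A B(1,2) B(1,2) L y' y]])
        (simp add: feq Dr_eq pair_adj2[OF A B(1,2) B(1,2) L y' y])
    then have "pair A (Suc m) e f = pair B (Suc m) (arens A B B m L e y') y"
      using pair_arens[OF A B(1,2) B(1,2) L eA y' y] by simp
    also have "arens A B B m L e y' = y'" using e y' by (simp add: left_unit_def up' m)
    finally show "pair A (Suc m) e f = pair B (Suc m) y' y" .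
  qed

  have idx: "n - 2 = m" "n - 1 = Suc m" "n + 1 = Suc n" by (simp_all add: m)
  show ?thesis
    unfolding idx Dl_def[symmetric] Dr_def[symmetric]
    using part1 part2 part3 part3' part4 part4' by blast
qed

end
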